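(* Let $n\ge2$, $\alpha,\beta>0$, $\alpha^2+\beta^2=1$, and $\gamma\in[0,1]$. Apply to $\rho_n(\gamma)$ the following procedure: measure the commuting Pauli operators $Z_iZ_{i+1}$, $i=1,\dots,n-1$, and postselect on all outcomes $+1$; then apply CNOT gates with qubit 1 as control and each of qubits $2,\dots,n$ as target; then discard qubits $2,\dots,n$. The postselection succeeds with probability $P_0+P_n\ge\alpha^2$, and the resulting single-qubit state is $$\tilde\rho(\gamma)=\frac1{P_0+P_n}\begin{pmatrix}P_0&c\\ c&P_n\end{pmatrix},$$ with Bloch coordinates $x=2c/(P_0+P_n)$, $y=0$, $z=(P_0-P_n)/(P_0+P_n)$. Moreover $$\rho_n(\gamma)\notin\mathcal S\iff \tilde\rho(\gamma)\notin\mathcal O\iff |x|+|z|>1\iff c>\min(P_0,P_n),$$ and $$(P_0+P_n)\bigl[\mathcal R(\tilde\rho(\gamma))-1\bigr]=\mathcal R(\rho_n(\gamma))-1.$$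
   Context: The single-qubit amplitude-damping channel $\mathcal E_\gamma$ has Kraus operators $E_0=|0\rangle\langle0|+\sqrt{1-\gamma}\,|1\rangle\langle1|$, $E_1=\sqrt{\gamma}\,|0\rangle\langle1|$. $\rho_n(\gamma)=\mathcal E_\gamma^{\otimes n}(|\psi_n\rangle\langle\psi_n|)$ with $|\psi_n\rangle=\alpha|0^n\rangle+\beta|1^n\rangle$; $P_0=\alpha^2+\beta^2\gamma^n$, $P_n=\beta^2(1-\gamma)^n$, $c=\alpha\beta(1-\gamma)^{n/2}$ are its entries $\langle0^n|\rho|0^n\rangle,\langle1^n|\rho|1^n\rangle,\langle0^n|\rho|1^n\rangle$. $\mathcal S$ is the $n$-qubit stabilizer polytope (convex hull of pure stabilizer states $C|0^n\rangle$, $C$ Clifford); $\mathcal O$ is the single-qubit stabilizer octahedron $\{\frac12(I+xX+yY+zZ):|x|+|y|+|z|\le1\}$. The robustness of magic is $\mathcal R(\rho)=\min\{\sum_j|q_j|:\rho=\sum_jq_j\sigma_j,\ q_j\in\mathbb R,\ \sigma_j$ in the stabilizer polytope of the appropriate number of qubits$\}$. *)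

theory Defs
  imports Complex_Main "Jordan_Normal_Form.Matrix"
begin

text \<open>Operators on n qubits are complex 2^n x 2^n matrices (Jordan_Normal_Form).
  Qubits are indexed 0..n-1 internally (paper: 1..n); qubit 0 is the first (most
  significant) tensor factor.\<close>

definition adj :: "complex mat \<Rightarrow> complex mat" where
  "adj A = mat (dim_col A) (dim_row A) (\<lambda>(i,j). cnj (A $$ (j,i)))"

definition mtrace :: "complex mat \<Rightarrow> complex" where
  "mtrace A = (\<Sum>i<dim_row A. A $$ (i,i))"

definition mat2 :: "complex \<Rightarrow> complex \<Rightarrow> complex \<Rightarrow> complex \<Rightarrow> complex mat" where
  "mat2 a b c d = mat 2 2 (\<lambda>(i,j). if i = 0 then (if j = 0 then a else b)
                                    else (if j = 0 then c else d))"

definition pI :: "complex mat" where "pI = mat2 1 0 0 1"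
definition pX :: "complex mat" where "pX = mat2 0 1 1 0"
definition pY :: "complex mat" where "pY = mat2 0 (- \<i>) \<i> 0"
definition pZ :: "complex mat" where "pZ = mat2 1 0 0 (-1)"
definition proj0 :: "complex mat" where "proj0 = mat2 1 0 0 0"
definition proj1 :: "complex mat" where "proj1 = mat2 0 0 0 1"

definition kron :: "complex mat \<Rightarrow> complex mat \<Rightarrow> complex mat" where
  "kron A B = mat (dim_row A * dim_row B) (dim_col A * dim_col B)
     (\<lambda>(i,j). A $$ (i div dim_row B, j div dim_col B) * B $$ (i mod dim_row B, j mod dim_col B))"

fun kron_list :: "complex mat list \<Rightarrow> complex mat" where
  "kron_list [] = 1\<^sub>m 1"
| "kron_list (A # As) = kron A (kron_list As)"

fun mat_prod_list :: "nat \<Rightarrow> complex mat list \<Rightarrow> complex mat" where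
  "mat_prod_list d [] = 1\<^sub>m d"
| "mat_prod_list d (A # As) = A * mat_prod_list d As"

definition on_qubit :: "nat \<Rightarrow> nat \<Rightarrow> complex mat \<Rightarrow> complex mat" where
  "on_qubit n k A = kron_list (map (\<lambda>j. if j = k then A else pI) [0..<n])"

definition pauli_strings :: "nat \<Rightarrow> complex mat set" where
  "pauli_strings n = {kron_list ps | ps. length ps = n \<and> set ps \<subseteq> {pI, pX, pY, pZ}}"

definition pauli_group :: "nat \<Rightarrow> complex mat set" where
  "pauli_group n = {w \<cdot>\<^sub>m P | w P. w \<in> {1, -1, \<i>, -\<i>} \<and> P \<in> pauli_strings n}"

definition unitary :: "nat \<Rightarrow> complex mat \<Rightarrow> bool" where
  "unitary n U \<longleftrightarrow> U \<in> carrier_mat (2^n) (2^n) \<and> U * adj U = 1\<^sub>m (2^n) \<and> adj U * U = 1\<^sub>m (2^n)"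

definition clifford :: "nat \<Rightarrow> complex mat \<Rightarrow> bool" where
  "clifford n U \<longleftrightarrow> unitary n U \<and> (\<forall>P \<in> pauli_group n. U * P * adj U \<in> pauli_group n)"

definition ket0_proj :: "nat \<Rightarrow> complex mat" where
  "ket0_proj n = mat (2^n) (2^n) (\<lambda>(i,j). if i = 0 \<and> j = 0 then 1 else 0)"

definition pure_stab :: "nat \<Rightarrow> complex mat set" where
  "pure_stab n = {U * ket0_proj n * adj U | U. clifford n U}"

definition stab_polytope :: "nat \<Rightarrow> complex mat set" where
  "stab_polytope n = {mat (2^n) (2^n) (\<lambda>(a,b). \<Sum>j<k. complex_of_real (p j) * (\<sigma> j) $$ (a,b))
      | (k::nat) p \<sigma>. (\<forall>j<k. p j \<ge> 0 \<and> \<sigma> j \<in> pure_stab n) \<and> (\<Sum>j<k. p j) = 1}"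

definition octahedron :: "complex mat set" where
  "octahedron = {(1/2::complex) \<cdot>\<^sub>m (pI + complex_of_real x \<cdot>\<^sub>m pX + complex_of_real y \<cdot>\<^sub>m pY
                    + complex_of_real z \<cdot>\<^sub>m pZ) | x y z. \<bar>x\<bar> + \<bar>y\<bar> + \<bar>z\<bar> \<le> 1}"

text \<open>Robustness of magic (as an infimum; the paper writes min).\<close>
definition robustness :: "nat \<Rightarrow> complex mat \<Rightarrow> real" where
  "robustness n \<rho> = Inf {(\<Sum>j<k. \<bar>q j\<bar>) | (k::nat) q \<sigma>.
      (\<forall>j<k. \<sigma> j \<in> stab_polytope n) \<and>
      \<rho> = mat (2^n) (2^n) (\<lambda>(a,b). \<Sum>j<k. complex_of_real (q j) * (\<sigma> j) $$ (a,b))}"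

definition ad_kraus :: "real \<Rightarrow> bool \<Rightarrow> complex mat" where
  "ad_kraus \<gamma> b = (if b then mat2 0 (complex_of_real (sqrt \<gamma>)) 0 0
                    else mat2 1 0 0 (complex_of_real (sqrt (1 - \<gamma>))))"

definition ad_channel_n :: "nat \<Rightarrow> real \<Rightarrow> complex mat \<Rightarrow> complex mat" where
  "ad_channel_n n \<gamma> \<rho> = mat (2^n) (2^n) (\<lambda>(a,b).
      \<Sum>bs \<in> {bs :: bool list. length bs = n}.
        (kron_list (map (ad_kraus \<gamma>) bs) * \<rho> * adj (kron_list (map (ad_kraus \<gamma>) bs))) $$ (a,b))"

text \<open>|psi_n><psi_n| with psi_n = alpha|0^n> + beta|1^n>.\<close>
definition psi_proj :: "nat \<Rightarrow> real \<Rightarrow> real \<Rightarrow> complex mat" where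
  "psi_proj n \<alpha> \<beta> = mat (2^n) (2^n) (\<lambda>(i,j).
     let amp = (\<lambda>k. if k = 0 then complex_of_real \<alpha> else if k = 2^n - 1 then complex_of_real \<beta> else 0)
     in amp i * cnj (amp j))"

definition rho_n :: "nat \<Rightarrow> real \<Rightarrow> real \<Rightarrow> real \<Rightarrow> complex mat" where
  "rho_n n \<alpha> \<beta> \<gamma> = ad_channel_n n \<gamma> (psi_proj n \<alpha> \<beta>)"

definition P0 :: "nat \<Rightarrow> real \<Rightarrow> real \<Rightarrow> real \<Rightarrow> real" where
  "P0 n \<alpha> \<beta> \<gamma> = \<alpha>^2 + \<beta>^2 * \<gamma>^n"
definition Pn :: "nat \<Rightarrow> real \<Rightarrow> real \<Rightarrow> real \<Rightarrow> real" where
  "Pn n \<alpha> \<beta> \<gamma> = \<beta>^2 * (1 - \<gamma>)^n"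
definition cc :: "nat \<Rightarrow> real \<Rightarrow> real \<Rightarrow> real \<Rightarrow> real" where
  "cc n \<alpha> \<beta> \<gamma> = \<alpha> * \<beta> * sqrt ((1 - \<gamma>)^n)"

definition postsel_proj :: "nat \<Rightarrow> complex mat" where
  "postsel_proj n = mat_prod_list (2^n)
     (map (\<lambda>i. (1/2::complex) \<cdot>\<^sub>m (1\<^sub>m (2^n) + on_qubit n i pZ * on_qubit n (Suc i) pZ)) [0..<n-1])"

definition cnot :: "nat \<Rightarrow> nat \<Rightarrow> nat \<Rightarrow> complex mat" where
  "cnot n c t = on_qubit n c proj0 +
     kron_list (map (\<lambda>j. if j = c then proj1 else if j = t then pX else pI) [0..<n])"

text \<open>Product of CNOTs, control qubit 0, targets 1..n-1 (they commute).\<close>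
definition cnot_cascade :: "nat \<Rightarrow> complex mat" where
  "cnot_cascade n = mat_prod_list (2^n) (map (\<lambda>t. cnot n 0 t) [1..<n])"

definition ptrace_rest :: "nat \<Rightarrow> complex mat \<Rightarrow> complex mat" where
  "ptrace_rest n \<rho> = mat 2 2 (\<lambda>(a,b). \<Sum>k<2^(n-1). \<rho> $$ (a * 2^(n-1) + k, b * 2^(n-1) + k))"

definition postsel_prob :: "nat \<Rightarrow> complex mat \<Rightarrow> complex" where
  "postsel_prob n \<rho> = mtrace (postsel_proj n * \<rho> * postsel_proj n)"

definition procedure_out :: "nat \<Rightarrow> complex mat \<Rightarrow> complex mat" where
  "procedure_out n \<rho> = (1 / postsel_prob n \<rho>) \<cdot>\<^sub>m
     ptrace_rest n (cnot_cascade n * (postsel_proj n * \<rho> * postsel_proj n) * adj (cnot_cascade n))"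

definition bloch_x :: "complex mat \<Rightarrow> real" where "bloch_x \<rho> = Re (mtrace (\<rho> * pX))"
definition bloch_y :: "complex mat \<Rightarrow> real" where "bloch_y \<rho> = Re (mtrace (\<rho> * pY))"
definition bloch_z :: "complex mat \<Rightarrow> real" where "bloch_z \<rho> = Re (mtrace (\<rho> * pZ))"

end

theory Submission
  imports Defs
begin

text \<open>All nonzero amplitudes of a pure stabilizer state have the same modulus, so every \<open>\<sigma>\<close> in the
  stabilizer polytope satisfies \<open>Re \<sigma>\<^sub>a\<^sub>b \<le> \<sigma>\<^sub>b\<^sub>b\<close> and \<open>Re \<sigma>\<^sub>a\<^sub>b \<ge> \<sigma>\<^sub>b\<^sub>b - 1\<close> for \<open>a \<noteq> b\<close>. With
  \<open>{a,b} = {0\<dots>0, 1\<dots>1}\<close> this yields a dual witness bounding the robustness from below by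
  \<open>1 + 2 (c - min P\<^sub>0 P\<^sub>n)\<close>. The damped state is diagonal apart from the coherence \<open>c\<close> between the two
  extreme basis states; writing it as \<open>2c\<close> times the GHZ state plus weighted basis states attains the
  bound. The one-qubit output has the same shape with \<open>n = 1\<close> and entries divided by \<open>P\<^sub>0 + P\<^sub>n\<close>,
  so one computation covers both sides.\<close>

subsection \<open>Kronecker products and Pauli strings\<close>

text \<open>The polytope is given through Clifford conjugation alone, so two facts about its
  vertices have to be extracted from that definition. Flatness of the amplitudes comes from the fact
  that a Clifford unitary turns strings of Z into Pauli group elements. For the upper bound, the
  basis states and the GHZ state need explicit Clifford unitaries; Hermitian involutions built from
  Pauli strings suffice for both.

  The two bounds meet because c^2 = \<alpha>^2 Pn <= P0 Pn, hence c <= max(P0, Pn). The corner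
  weights of the decomposition are P0 - c and Pn - c, so at most one of them is negative, and the
  sum of absolute values exceeds 1 by twice its size. The witness is not symmetric in its two
  indices; using it in both orders yields the minimum.

  The excess of the robustness over 1 is then 2 max(0, c - min(P0, Pn)), which is positively
  homogeneous of degree one in the three entries. Dividing them by P0 + Pn divides the excess by the
  same factor, and this is the relation between the two robustnesses.\<close>

lemma mult_mat_index:
  assumes "A \<in> carrier_mat n m" "B \<in> carrier_mat m p" "i < n" "j < p"
  shows "(A * B) $$ (i,j) = (\<Sum>k<m. A $$ (i,k) * B $$ (k,j))"
  using assms by (auto simp: scalar_prod_def lessThan_atLeast0 intro!: sum.cong)

lemma adj_carrier [simp]: "A \<in> carrier_mat n m \<Longrightarrow> adj A \<in> carrier_mat m n"
  by (auto simp: adj_def)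

lemma adj_index: "A \<in> carrier_mat n m \<Longrightarrow> i < m \<Longrightarrow> j < n \<Longrightarrow> adj A $$ (i,j) = cnj (A $$ (j,i))"
  by (auto simp: adj_def)

lemma conj_index:
  assumes U: "U \<in> carrier_mat d d" and M: "M \<in> carrier_mat d d" and a: "a < d" and b: "b < d"
  shows "(U * M * adj U) $$ (a,b) = (\<Sum>k<d. \<Sum>l<d. U $$ (a,l) * M $$ (l,k) * cnj (U $$ (b,k)))"
proof -
  have "(U * M * adj U) $$ (a,b) = (\<Sum>k<d. (U * M) $$ (a,k) * adj U $$ (k,b))"
    by (rule mult_mat_index[OF mult_carrier_mat[OF U M] adj_carrier[OF U] a b])
  also have "\<dots> = (\<Sum>k<d. \<Sum>l<d. U $$ (a,l) * M $$ (l,k) * cnj (U $$ (b,k)))"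
    using b by (intro sum.cong refl)
      (simp add: mult_mat_index[OF U M a] adj_index[OF U] sum_distrib_right)
  finally show ?thesis .
qed

lemma kron_carrier [simp]:
  "A \<in> carrier_mat n m \<Longrightarrow> B \<in> carrier_mat p q \<Longrightarrow> kron A B \<in> carrier_mat (n * p) (m * q)"
  by (auto simp: kron_def)

lemma kron_index:
  assumes "A \<in> carrier_mat n m" "B \<in> carrier_mat p q" "i < n * p" "j < m * q"
  shows "kron A B $$ (i,j) = A $$ (i div p, j div q) * B $$ (i mod p, j mod q)"
  using assms by (auto simp: kron_def)

text \<open>An index below \<open>m * p\<close> is a pair of quotient and remainder:
  \<open>sum.nat_group\<close> cuts the range into blocks of length \<open>p\<close>. The
  mixed-product rule \<open>kron_mult\<close> and the recursion over qubits in
  \<open>sum_flip_amp_square\<close> rest on this.\<close>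

lemma sum_div_mod:
  fixes f :: "nat \<Rightarrow> nat \<Rightarrow> 'a::comm_monoid_add"
  shows "(\<Sum>k<m*p. f (k div p) (k mod p)) = (\<Sum>i<m. \<Sum>j<p. f i j)"
proof -
  have "(\<Sum>k<m*p. f (k div p) (k mod p)) = (\<Sum>i<m. \<Sum>k=i*p..<i*p+p. f (k div p) (k mod p))"
    by (rule sum.nat_group[symmetric])
  also have "\<dots> = (\<Sum>i<m. \<Sum>j<p. f i j)"
  proof (rule sum.cong[OF refl])
    fix i
    have "(\<Sum>k=i*p..<i*p+p. f (k div p) (k mod p)) = (\<Sum>k=0+i*p..<p+i*p. f (k div p) (k mod p))"
      by (simp add: add.commute)
    also have "\<dots> = (\<Sum>j=0..<p. f ((j + i*p) div p) ((j + i*p) mod p))"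
      by (rule sum.shift_bounds_nat_ivl)
    also have "\<dots> = (\<Sum>j<p. f i j)"
      by (rule sum.cong) auto
    finally show "(\<Sum>k=i*p..<i*p+p. f (k div p) (k mod p)) = (\<Sum>j<p. f i j)" .
  qed
  finally show ?thesis .
qed

lemma div_less_mult: "(i::nat) < n * p \<Longrightarrow> i div p < n"
  by (simp add: less_mult_imp_div_less)

lemma mod_less_mult: "(i::nat) < n * p \<Longrightarrow> i mod p < p"
  by (metis mod_less_divisor mult_is_0 not_gr_zero not_less_zero)

lemma kron_mult:
  assumes A: "A \<in> carrier_mat n m" and B: "B \<in> carrier_mat p q"
    and C: "C \<in> carrier_mat m k" and D: "D \<in> carrier_mat q r"
  shows "kron A B * kron C D = kron (A * C) (B * D)"
proof (rule eq_matI)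
  note car = kron_carrier[OF A B] kron_carrier[OF C D]
    kron_carrier[OF mult_carrier_mat[OF A C] mult_carrier_mat[OF B D]]
  fix i j assume "i < dim_row (kron (A * C) (B * D))" "j < dim_col (kron (A * C) (B * D))"
  then have i: "i < n * p" and j: "j < k * r" using car by auto
  have "(kron A B * kron C D) $$ (i,j) = (\<Sum>l<m*q. kron A B $$ (i,l) * kron C D $$ (l,j))"
    by (rule mult_mat_index[OF car(1,2) i j])
  also have "\<dots> = (\<Sum>l<m*q. (A $$ (i div p, l div q) * C $$ (l div q, j div r))
      * (B $$ (i mod p, l mod q) * D $$ (l mod q, j mod r)))"
    using i j by (intro sum.cong) (auto simp: kron_index[OF A B] kron_index[OF C D])
  also have "\<dots> = (\<Sum>s<m. \<Sum>t<q. (A $$ (i div p, s) * C $$ (s, j div r))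
      * (B $$ (i mod p, t) * D $$ (t, j mod r)))"
    by (rule sum_div_mod)
  also have "\<dots> = (A * C) $$ (i div p, j div r) * (B * D) $$ (i mod p, j mod r)"
    using i j by (simp add: mult_mat_index[OF A C] mult_mat_index[OF B D] div_less_mult
        mod_less_mult sum_product)
  also have "\<dots> = kron (A * C) (B * D) $$ (i,j)"
    by (rule kron_index[symmetric]) (use A B C D i j in auto)
  finally show "(kron A B * kron C D) $$ (i,j) = kron (A * C) (B * D) $$ (i,j)" .
qed (use A B C D in \<open>auto simp: kron_def\<close>)

lemma smult_mat_one: "(1::'a::monoid_mult) \<cdot>\<^sub>m A = A"
  by (rule eq_matI) auto

lemma smult_mat_smult: "w \<cdot>\<^sub>m (v \<cdot>\<^sub>m A) = (w * v :: 'a::semigroup_mult) \<cdot>\<^sub>m A"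
  by (rule eq_matI) (auto simp: mult.assoc)

lemma kron_smult: "kron (w \<cdot>\<^sub>m A) (v \<cdot>\<^sub>m B) = (w * v) \<cdot>\<^sub>m kron A B"
  by (rule eq_matI) (auto simp: kron_def div_less_mult mod_less_mult)

lemma adj_kron: "adj (kron A B) = kron (adj A) (adj B)"
  by (rule eq_matI) (auto simp: kron_def adj_def div_less_mult mod_less_mult)

lemma kron_one: "kron (1\<^sub>m n) (1\<^sub>m m) = 1\<^sub>m (n * m)"
proof (rule eq_matI)
  fix i j assume "i < dim_row (1\<^sub>m (n * m) :: complex mat)" "j < dim_col (1\<^sub>m (n * m) :: complex mat)"
  then have "i < n * m" "j < n * m" by auto
  moreover have "i = j \<longleftrightarrow> i div m = j div m \<and> i mod m = j mod m"
    by (metis div_mult_mod_eq)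
  ultimately show "kron (1\<^sub>m n) (1\<^sub>m m) $$ (i,j) = 1\<^sub>m (n * m) $$ (i,j)"
    by (auto simp: kron_def div_less_mult mod_less_mult)
qed (auto simp: kron_def)

lemma kron_list_carrier:
  "set As \<subseteq> carrier_mat 2 2 \<Longrightarrow> kron_list As \<in> carrier_mat (2 ^ length As) (2 ^ length As)"
proof (induction As)
  case (Cons A As)
  then show ?case using kron_carrier[of A 2 2 "kron_list As"] by simp
qed simp

section \<open>Two-by-two matrices, Pauli matrices and Pauli strings\<close>

lemma mat2_carrier [simp]: "mat2 a b c d \<in> carrier_mat 2 2"
  by (simp add: mat2_def)

lemma mat2_index [simp]:
  "mat2 a b c d $$ (0,0) = a" "mat2 a b c d $$ (0,Suc 0) = b"
  "mat2 a b c d $$ (Suc 0,0) = c" "mat2 a b c d $$ (Suc 0,Suc 0) = d"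
  by (simp_all add: mat2_def)

lemma mat2_mult: "mat2 a b c d * mat2 a' b' c' d'
  = mat2 (a * a' + b * c') (a * b' + b * d') (c * a' + d * c') (c * b' + d * d')"
  by (rule eq_matI) (auto simp: mat2_def scalar_prod_def numeral_2_eq_2)

lemma mat2_add: "mat2 a b c d + mat2 a' b' c' d' = mat2 (a + a') (b + b') (c + c') (d + d')"
  by (rule eq_matI) (auto simp: mat2_def)

lemma mat2_smult: "w \<cdot>\<^sub>m mat2 a b c d = mat2 (w * a) (w * b) (w * c) (w * d)"
  by (rule eq_matI) (auto simp: mat2_def)

lemma mat2_adj: "adj (mat2 a b c d) = mat2 (cnj a) (cnj c) (cnj b) (cnj d)"
  by (rule eq_matI) (auto simp: mat2_def adj_def)

lemma mat2_eq_iff: "mat2 a b c d = mat2 a' b' c' d' \<longleftrightarrow> a = a' \<and> b = b' \<and> c = c' \<and> d = d'"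
  by (metis mat2_index)

lemma mat2_one: "mat2 1 0 0 1 = 1\<^sub>m 2"
  by (rule eq_matI) (auto simp: mat2_def)

lemmas pauli_defs = pI_def pX_def pY_def pZ_def
lemmas mat2_simps = mat2_mult mat2_add mat2_smult mat2_adj mat2_eq_iff

abbreviation paulis :: "complex mat set" where "paulis \<equiv> {pI, pX, pY, pZ}"
abbreviation phases :: "complex set" where "phases \<equiv> {1, -1, \<i>, -\<i>}"

lemma paulis_carrier: "paulis \<subseteq> carrier_mat 2 2"
  by (simp add: pauli_defs)

lemma paulis_mult:
  assumes "p \<in> paulis" "q \<in> paulis"
  shows "\<exists>w\<in>phases. \<exists>r\<in>paulis. p * q = w \<cdot>\<^sub>m r"
  using assms by (auto simp: pauli_defs mat2_simps)

lemma paulis_commute: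
  assumes "p \<in> paulis" "q \<in> paulis"
  shows "\<exists>s\<in>{1,-1}. p * q = s \<cdot>\<^sub>m (q * p)"
  using assms by (auto simp: pauli_defs mat2_simps)

lemma paulis_square: "p \<in> paulis \<Longrightarrow> p * p = 1\<^sub>m 2"
  by (auto simp: pauli_defs mat2_simps mat2_one[symmetric])

lemma paulis_adj: "p \<in> paulis \<Longrightarrow> adj p = p"
  by (auto simp: pauli_defs mat2_simps)

lemma pauli_strings_0: "pauli_strings 0 = {1\<^sub>m 1}"
  by (auto simp: pauli_strings_def intro: exI[of _ "[]"])

lemma pauli_strings_Suc: "pauli_strings (Suc n) = {kron p Q | p Q. p \<in> paulis \<and> Q \<in> pauli_strings n}"
proof (intro equalityI subsetI)
  fix P assume "P \<in> pauli_strings (Suc n)"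
  then obtain ps where "P = kron_list ps" "length ps = Suc n" "set ps \<subseteq> paulis"
    unfolding pauli_strings_def by blast
  then show "P \<in> {kron p Q | p Q. p \<in> paulis \<and> Q \<in> pauli_strings n}"
    by (cases ps) (auto simp: pauli_strings_def)
next
  fix P assume "P \<in> {kron p Q | p Q. p \<in> paulis \<and> Q \<in> pauli_strings n}"
  then obtain p ps where "P = kron p (kron_list ps)" "length ps = n" "set ps \<subseteq> paulis" "p \<in> paulis"
    unfolding pauli_strings_def by blast
  then have "P = kron_list (p # ps)" "length (p # ps) = Suc n" "set (p # ps) \<subseteq> paulis" by simp_all
  then show "P \<in> pauli_strings (Suc n)" unfolding pauli_strings_def by blast
qed

lemma pauli_strings_carrier: "P \<in> pauli_strings n \<Longrightarrow> P \<in> carrier_mat (2^n) (2^n)"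
  using kron_list_carrier paulis_carrier unfolding pauli_strings_def by blast

lemma pauli_strings_square: "P \<in> pauli_strings n \<Longrightarrow> P * P = 1\<^sub>m (2^n)"
proof (induction n arbitrary: P)
  case (Suc n)
  then obtain p Q where "P = kron p Q" "p \<in> paulis" "Q \<in> pauli_strings n"
    by (auto simp: pauli_strings_Suc)
  moreover from this have "p \<in> carrier_mat 2 2" "Q \<in> carrier_mat (2^n) (2^n)"
    using paulis_carrier pauli_strings_carrier by blast+
  ultimately show ?case
    using Suc.IH paulis_square by (simp add: kron_mult kron_one)
qed (simp add: pauli_strings_0)

lemma pauli_strings_adj: "P \<in> pauli_strings n \<Longrightarrow> adj P = P"
proof (induction n arbitrary: P)
  case 0
  then show ?case by (auto simp: pauli_strings_0 adj_def intro!: eq_matI)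
next
  case (Suc n)
  then show ?case by (auto simp: pauli_strings_Suc adj_kron paulis_adj)
qed

lemma pauli_strings_commute:
  "P \<in> pauli_strings n \<Longrightarrow> Q \<in> pauli_strings n \<Longrightarrow> \<exists>s\<in>{1,-1}. P * Q = s \<cdot>\<^sub>m (Q * P)"
proof (induction n arbitrary: P Q)
  case 0
  then show ?case by (simp add: pauli_strings_0 smult_mat_one)
next
  case (Suc n)
  from Suc.prems obtain p P' q Q' where eq: "P = kron p P'" "Q = kron q Q'"
    and p: "p \<in> paulis" "q \<in> paulis" and P': "P' \<in> pauli_strings n" "Q' \<in> pauli_strings n"
    by (auto simp: pauli_strings_Suc)
  obtain s where s: "s \<in> {1,-1}" "p * q = s \<cdot>\<^sub>m (q * p)" using paulis_commute[OF p] by blast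
  obtain t where t: "t \<in> {1,-1}" "P' * Q' = t \<cdot>\<^sub>m (Q' * P')" using Suc.IH[OF P'] by blast
  have car: "p \<in> carrier_mat 2 2" "q \<in> carrier_mat 2 2"
    "P' \<in> carrier_mat (2^n) (2^n)" "Q' \<in> carrier_mat (2^n) (2^n)"
    using p P' paulis_carrier pauli_strings_carrier by blast+
  have "P * Q = (s * t) \<cdot>\<^sub>m (Q * P)"
    unfolding eq kron_mult[OF car(1,3,2,4)] kron_mult[OF car(2,4,1,3)] s(2) t(2) kron_smult ..
  moreover have "s * t \<in> {1,-1}" using s(1) t(1) by auto
  ultimately show ?case by blast
qed

lemma phases_mult: "w \<in> phases \<Longrightarrow> v \<in> phases \<Longrightarrow> w * v \<in> phases"
  by auto

lemma pauli_group_smult: "w \<in> phases \<Longrightarrow> G \<in> pauli_group n \<Longrightarrow> w \<cdot>\<^sub>m G \<in> pauli_group n"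
  unfolding pauli_group_def using smult_mat_smult phases_mult by blast

lemma pauli_group_string: "P \<in> pauli_strings n \<Longrightarrow> P \<in> pauli_group n"
  unfolding pauli_group_def using smult_mat_one[of P] by (metis (mono_tags, lifting) insertI1 mem_Collect_eq)

lemma pauli_strings_mult:
  "P \<in> pauli_strings n \<Longrightarrow> Q \<in> pauli_strings n \<Longrightarrow> P * Q \<in> pauli_group n"
proof (induction n arbitrary: P Q)
  case 0
  then show ?case by (simp add: pauli_strings_0 pauli_group_string)
next
  case (Suc n)
  from Suc.prems obtain p P' q Q' where eq: "P = kron p P'" "Q = kron q Q'"
    and p: "p \<in> paulis" "q \<in> paulis" and P': "P' \<in> pauli_strings n" "Q' \<in> pauli_strings n"
    by (auto simp: pauli_strings_Suc)
  obtain s r where s: "s \<in> phases" "p * q = s \<cdot>\<^sub>m r" "r \<in> paulis" using paulis_mult[OF p] by blast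
  obtain t R where t: "t \<in> phases" "P' * Q' = t \<cdot>\<^sub>m R" "R \<in> pauli_strings n"
    using Suc.IH[OF P'] unfolding pauli_group_def by blast
  have car: "p \<in> carrier_mat 2 2" "q \<in> carrier_mat 2 2"
    "P' \<in> carrier_mat (2^n) (2^n)" "Q' \<in> carrier_mat (2^n) (2^n)"
    using p P' paulis_carrier pauli_strings_carrier by blast+
  have "P * Q = (s * t) \<cdot>\<^sub>m kron r R"
    unfolding eq kron_mult[OF car(1,3,2,4)] s(2) t(2) kron_smult ..
  moreover have "kron r R \<in> pauli_strings (Suc n)" using s(3) t(3) by (auto simp: pauli_strings_Suc)
  ultimately show ?case using phases_mult[OF s(1) t(1)] unfolding pauli_group_def by blast
qed

lemma pauli_group_times_string:
  assumes "G \<in> pauli_group n" "Q \<in> pauli_strings n" shows "G * Q \<in> pauli_group n"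
proof -
  obtain w P where w: "w \<in> phases" "G = w \<cdot>\<^sub>m P" "P \<in> pauli_strings n"
    using assms(1) unfolding pauli_group_def by blast
  have "G * Q = w \<cdot>\<^sub>m (P * Q)"
    using w pauli_strings_carrier[OF w(3)] pauli_strings_carrier[OF assms(2)]
    by (simp add: mult_smult_assoc_mat)
  then show ?thesis using pauli_group_smult[OF w(1) pauli_strings_mult[OF w(3) assms(2)]] by simp
qed

subsection \<open>Clifford unitaries preparing basis and GHZ states\<close>

text \<open>A Hermitian involution is unitary and its own adjoint. Scalars pull out of the
  conjugation, so only phase-free strings have to be checked.\<close>

lemma clifford_hermitianI:
  assumes car: "U \<in> carrier_mat (2^n) (2^n)" and adj: "adj U = U" and sq: "U * U = 1\<^sub>m (2^n)"
    and conj: "\<And>Q. Q \<in> pauli_strings n \<Longrightarrow> U * Q * U \<in> pauli_group n"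
  shows "clifford n U"
  unfolding clifford_def unitary_def adj
proof (intro conjI ballI)
  fix G assume "G \<in> pauli_group n"
  then obtain w Q where w: "w \<in> phases" "G = w \<cdot>\<^sub>m Q" "Q \<in> pauli_strings n"
    unfolding pauli_group_def by blast
  have "U * G * U = w \<cdot>\<^sub>m (U * Q * U)"
    using car pauli_strings_carrier[OF w(3)]
    by (simp add: w(2) mult_smult_distrib[OF car] mult_smult_assoc_mat[of _ "2^n" "2^n"])
  then show "U * G * U \<in> pauli_group n" using pauli_group_smult[OF w(1) conj[OF w(3)]] by simp
qed (use car sq in auto)

text \<open>Two Pauli strings commute or anticommute, so conjugation changes \<open>Q\<close> at
  most by a sign. This supplies the bit flips that prepare the basis states.\<close>

lemma clifford_pauli_string:
  assumes P: "P \<in> pauli_strings n" shows "clifford n P"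
proof (rule clifford_hermitianI)
  note Pc = pauli_strings_carrier[OF P]
  fix Q assume Q: "Q \<in> pauli_strings n"
  note Qc = pauli_strings_carrier[OF Q]
  obtain s where s: "s \<in> {1,-1}" "P * Q = s \<cdot>\<^sub>m (Q * P)" using pauli_strings_commute[OF P Q] by blast
  have "P * Q * P = s \<cdot>\<^sub>m (Q * P * P)"
    using Pc Qc by (simp add: s(2) mult_smult_assoc_mat[of _ "2^n" "2^n"])
  also have "Q * P * P = Q"
    using Pc Qc by (simp add: assoc_mult_mat[OF Qc Pc Pc] pauli_strings_square[OF P])
  finally have "P * Q * P = s \<cdot>\<^sub>m Q" .
  moreover have "s \<in> phases" using s(1) by blast
  ultimately show "P * Q * P \<in> pauli_group n"
    using pauli_group_smult pauli_group_string[OF Q] by metis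
qed (simp_all add: pauli_strings_carrier[OF P] pauli_strings_adj[OF P] pauli_strings_square[OF P])

text \<open>The Hadamard gate is the instance \<open>A = Z\<close>, \<open>B = X\<close>.\<close>

lemma clifford_anticommuting:
  assumes A: "A \<in> pauli_strings n" and B: "B \<in> pauli_strings n" and AB: "B * A = - 1 \<cdot>\<^sub>m (A * B)"
  shows "clifford n (complex_of_real (1 / sqrt 2) \<cdot>\<^sub>m (A + B))"
proof (rule clifford_hermitianI)
  define h where "h = complex_of_real (1 / sqrt 2)"
  define U where "U = h \<cdot>\<^sub>m (A + B)"
  let ?N = "2^n :: nat"
  note Ac = pauli_strings_carrier[OF A] and Bc = pauli_strings_carrier[OF B]
  note ABc = mult_carrier_mat[OF Ac Bc] mult_carrier_mat[OF Bc Ac]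
  have hh: "h * h = 1/2" unfolding h_def by (simp flip: of_real_mult)
  have Uc: "U \<in> carrier_mat ?N ?N" using Ac Bc by (simp add: U_def)
  show "h \<cdot>\<^sub>m (A + B) \<in> carrier_mat ?N ?N" using Uc by (simp add: U_def)
  have "adj U = h \<cdot>\<^sub>m (adj A + adj B)"
    using Ac Bc by (intro eq_matI) (auto simp: adj_def U_def h_def algebra_simps)
  then show adjU: "adj (h \<cdot>\<^sub>m (A + B)) = h \<cdot>\<^sub>m (A + B)"
    using pauli_strings_adj[OF A] pauli_strings_adj[OF B] by (simp add: U_def)
  \<comment> \<open>\<open>A\<close> and \<open>B\<close> square to the identity and anticommute.
    The case \<open>s = t = 1\<close> gives \<open>U * U\<close>; with the commutation signs of
    \<open>Q\<close> the same formula gives the conjugation.\<close>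
  have prod: "(s \<cdot>\<^sub>m A + t \<cdot>\<^sub>m B) * (A + B) = (s + t) \<cdot>\<^sub>m 1\<^sub>m ?N + (s - t) \<cdot>\<^sub>m (A * B)" for s t
  proof -
    have "(s \<cdot>\<^sub>m A + t \<cdot>\<^sub>m B) * (A + B)
        = s \<cdot>\<^sub>m (A * A) + t \<cdot>\<^sub>m (B * A) + (s \<cdot>\<^sub>m (A * B) + t \<cdot>\<^sub>m (B * B))"
      using Ac Bc by (simp add: add_mult_distrib_mat[of _ ?N ?N] mult_add_distrib_mat[of _ ?N ?N _ ?N]
          mult_smult_assoc_mat[of _ ?N ?N])
    also have "\<dots> = (s + t) \<cdot>\<^sub>m 1\<^sub>m ?N + (s - t) \<cdot>\<^sub>m (A * B)"
      unfolding AB pauli_strings_square[OF A] pauli_strings_square[OF B]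
      using ABc by (intro eq_matI) (auto simp: algebra_simps simp del: index_mult_mat)
    finally show ?thesis .
  qed
  have "U * U = (h * h) \<cdot>\<^sub>m ((A + B) * (A + B))"
    using Ac Bc by (simp add: U_def mult_smult_assoc_mat[of _ ?N ?N _ ?N] mult_smult_distrib[of _ ?N ?N _ ?N]
        smult_mat_smult)
  also have "(A + B) * (A + B) = 2 \<cdot>\<^sub>m 1\<^sub>m ?N"
    using prod[of 1 1] ABc by (auto simp: smult_mat_one intro!: eq_matI simp del: index_mult_mat)
  finally show "h \<cdot>\<^sub>m (A + B) * (h \<cdot>\<^sub>m (A + B)) = 1\<^sub>m ?N"
    using hh by (simp add: U_def smult_mat_smult smult_mat_one)
  fix Q assume Q: "Q \<in> pauli_strings n"
  note Qc = pauli_strings_carrier[OF Q]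
  obtain s where s: "s \<in> {1,-1}" "A * Q = s \<cdot>\<^sub>m (Q * A)" using pauli_strings_commute[OF A Q] by blast
  obtain t where t: "t \<in> {1,-1}" "B * Q = t \<cdot>\<^sub>m (Q * B)" using pauli_strings_commute[OF B Q] by blast
  have Sc: "A + B \<in> carrier_mat ?N ?N" using Bc by simp
  have "U * Q * U = (h * h) \<cdot>\<^sub>m ((A + B) * Q * (A + B))"
    unfolding U_def mult_smult_assoc_mat[OF Sc Qc] mult_smult_distrib[OF smult_carrier_mat[OF mult_carrier_mat[OF Sc Qc]] Sc]
      mult_smult_assoc_mat[OF mult_carrier_mat[OF Sc Qc] Sc] smult_mat_smult ..
  also have "(A + B) * Q = Q * (s \<cdot>\<^sub>m A + t \<cdot>\<^sub>m B)"
    using Ac Bc Qc by (simp add: add_mult_distrib_mat[of _ ?N ?N] mult_add_distrib_mat[of _ ?N ?N _ ?N]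
        s(2) t(2) mult_smult_distrib[of _ ?N ?N _ ?N])
  also have "\<dots> * (A + B) = Q * ((s + t) \<cdot>\<^sub>m 1\<^sub>m ?N + (s - t) \<cdot>\<^sub>m (A * B))"
    unfolding prod[symmetric] by (rule assoc_mult_mat[of _ ?N ?N _ ?N _ ?N]) (use Ac Bc Qc in simp_all)
  finally have UQU: "U * Q * U = (1/2) \<cdot>\<^sub>m (Q * ((s + t) \<cdot>\<^sub>m 1\<^sub>m ?N + (s - t) \<cdot>\<^sub>m (A * B)))"
    unfolding hh .
  \<comment> \<open>With equal signs \<open>Q\<close> is fixed up to sign; with opposite signs it
    picks up the factor \<open>A * B\<close>. For \<open>Q = A\<close> the result is
    \<open>B\<close>, the exchange known from the Hadamard gate.\<close>
  have "U * Q * U = s \<cdot>\<^sub>m Q \<or> U * Q * U = s \<cdot>\<^sub>m (Q * A * B)"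
  proof (cases "s = t")
    case True
    have "(s + t) \<cdot>\<^sub>m 1\<^sub>m ?N + (s - t) \<cdot>\<^sub>m (A * B) = (2 * s) \<cdot>\<^sub>m 1\<^sub>m ?N"
      using ABc True by (intro eq_matI) (auto simp del: index_mult_mat)
    then show ?thesis
      using Qc unfolding UQU by (simp add: mult_smult_distrib[of _ ?N ?N _ ?N] smult_mat_smult)
  next
    case False
    then have "t = - s" using s(1) t(1) by auto
    then have "(s + t) \<cdot>\<^sub>m 1\<^sub>m ?N + (s - t) \<cdot>\<^sub>m (A * B) = (2 * s) \<cdot>\<^sub>m (A * B)"
      using ABc by (intro eq_matI) (auto simp del: index_mult_mat)
    then show ?thesis
      using Qc ABc Ac Bc unfolding UQU
      by (simp add: mult_smult_distrib[of _ ?N ?N _ ?N] smult_mat_smult assoc_mult_mat[of _ ?N ?N])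
  qed
  moreover have "s \<in> phases" using s(1) by blast
  moreover have "Q * A * B \<in> pauli_group n"
    by (intro pauli_group_times_string pauli_strings_mult Q A B)
  ultimately have "U * Q * U \<in> pauli_group n"
    using pauli_group_smult pauli_group_string[OF Q] by metis
  then show "h \<cdot>\<^sub>m (A + B) * Q * (h \<cdot>\<^sub>m (A + B)) \<in> pauli_group n" by (simp add: U_def)
qed

section \<open>Basis indices as bit strings, and the preparation of stabilizer states\<close>

lemma sum_two:
  fixes f :: "nat \<Rightarrow> 'a::comm_monoid_add"
  assumes "\<And>k. k < d \<Longrightarrow> k \<noteq> 0 \<Longrightarrow> k \<noteq> m \<Longrightarrow> f k = 0" "m \<noteq> 0" "m < d"
  shows "(\<Sum>k<d. f k) = f 0 + f m"
proof -
  have "(\<Sum>k<d. f k) = (\<Sum>k\<in>{0,m}. f k)"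
    by (rule sum.mono_neutral_right) (use assms in auto)
  then show ?thesis using assms(2) by simp
qed

lemma top_index: "n \<ge> 1 \<Longrightarrow> 2^n - 1 \<noteq> (0::nat)" "2^n - 1 < (2^n::nat)"
  using one_less_power[of "2::nat" n] by simp_all

text \<open>Most significant bit first, matching the order of the tensor factors. The value is junk
  unless \<open>k < n\<close>.\<close>

definition qbit :: "nat \<Rightarrow> nat \<Rightarrow> nat \<Rightarrow> nat" where
  "qbit n a k = of_bool (bit a (n - Suc k))"

lemma qbit_less [simp]: "qbit n a k < 2"
  by (simp add: qbit_def)

lemma qbit_Suc_0: "a < 2 ^ Suc n \<Longrightarrow> qbit (Suc n) a 0 = a div 2 ^ n"
proof -
  assume "a < 2 ^ Suc n"
  then have "a div 2^n < 2" by (simp add: less_mult_imp_div_less)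
  then have "a div 2^n = 0 \<or> a div 2^n = 1" by auto
  then show ?thesis by (auto simp: qbit_def bit_iff_odd)
qed

lemma qbit_Suc_Suc: "k < n \<Longrightarrow> qbit (Suc n) a (Suc k) = qbit n (a mod 2 ^ n) k"
  by (simp add: qbit_def bit_take_bit_iff flip: take_bit_eq_mod)

lemma bit_less_exp: "(a::nat) < 2 ^ n \<Longrightarrow> bit a k \<Longrightarrow> k < n"
  by (metis bit_take_bit_iff take_bit_nat_eq_self)

lemma qbit_ext:
  assumes "a < 2 ^ n" "b < 2 ^ n"
  shows "(\<forall>k<n. qbit n a k = qbit n b k) \<longleftrightarrow> a = b"
proof
  assume *: "\<forall>k<n. qbit n a k = qbit n b k"
  show "a = b"
  proof (rule bit_eqI)
    fix m
    show "bit a m = bit b m"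
    proof (cases "m < n")
      case True
      then have "qbit n a (n - Suc m) = qbit n b (n - Suc m)" using * by simp
      with True show ?thesis by (simp add: qbit_def of_bool_eq_iff)
    next
      case False
      then show ?thesis using bit_less_exp assms by blast
    qed
  qed
qed simp

text \<open>An entry of a tensor product is the product of the single-qubit entries selected by the
  bits of row and column. Later matrix computations thereby reduce to case distinctions on one
  bit.\<close>

lemma kron_list_index:
  assumes "length As = n" "set As \<subseteq> carrier_mat 2 2" "a < 2 ^ n" "b < 2 ^ n"
  shows "kron_list As $$ (a,b) = (\<Prod>k<n. As ! k $$ (qbit n a k, qbit n b k))"
  using assms
proof (induction As arbitrary: n a b)
  case (Cons A As)
  then obtain m where n: "n = Suc m" "length As = m" by auto
  have carA: "A \<in> carrier_mat 2 2" and carAs: "kron_list As \<in> carrier_mat (2^m) (2^m)"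
    using Cons.prems kron_list_carrier[of As] n by auto
  have ab: "a mod 2^m < 2^m" "b mod 2^m < 2^m" by simp_all
  have "kron_list (A # As) $$ (a,b)
      = A $$ (a div 2^m, b div 2^m) * kron_list As $$ (a mod 2^m, b mod 2^m)"
    using Cons.prems n by (simp add: kron_index[OF carA carAs])
  also have "kron_list As $$ (a mod 2^m, b mod 2^m)
      = (\<Prod>k<m. As ! k $$ (qbit m (a mod 2^m) k, qbit m (b mod 2^m) k))"
    using Cons.prems n by (intro Cons.IH) auto
  also have "\<dots> = (\<Prod>k<m. (A # As) ! Suc k $$ (qbit n a (Suc k), qbit n b (Suc k)))"
    unfolding n by (intro prod.cong) (auto simp: qbit_Suc_Suc)
  also have "A $$ (a div 2^m, b div 2^m) = (A # As) ! 0 $$ (qbit n a 0, qbit n b 0)"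
    using Cons.prems n by (simp add: qbit_Suc_0)
  finally show ?case unfolding n prod.lessThan_Suc_shift by simp
qed simp

lemma prod_of_bool: "finite A \<Longrightarrow> (\<Prod>k\<in>A. of_bool (Q k)) = (of_bool (\<forall>k\<in>A. Q k) :: 'a::comm_semiring_1)"
  by (induction A rule: finite_induct) auto

lemma qbit_0 [simp]: "qbit n 0 k = 0"
  by (simp add: qbit_def)

lemma qbit_top [simp]: "k < n \<Longrightarrow> qbit n (2 ^ n - Suc 0) k = 1"
  using bit_mask_iff[where ?'a = nat, of n "n - Suc k"] by (simp add: qbit_def mask_eq_exp_minus_1)

text \<open>The bit-flip string that takes |0...0> to |a>: the identity for \<open>a = 0\<close>,
  and X on every qubit for \<open>a = 2^n - 1\<close>.\<close>

definition xmask :: "nat \<Rightarrow> nat \<Rightarrow> complex mat list" where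
  "xmask n a = map (\<lambda>k. if qbit n a k = 1 then pX else pI) [0..<n]"

lemma xmask_pauli: "kron_list (xmask n a) \<in> pauli_strings n"
  unfolding pauli_strings_def xmask_def by (auto intro!: exI[of _ "map (\<lambda>k. if qbit n a k = 1 then pX else pI) [0..<n]"])

lemma qbit_cases: "qbit n a k = 0 \<or> qbit n a k = 1"
  by (simp add: qbit_def)

lemma xmask_column:
  assumes "i < 2 ^ n" "a < 2 ^ n"
  shows "kron_list (xmask n a) $$ (i,0) = of_bool (i = a)"
proof -
  have "kron_list (xmask n a) $$ (i,0) = (\<Prod>k<n. xmask n a ! k $$ (qbit n i k, qbit n 0 k))"
    by (rule kron_list_index) (use assms in \<open>auto simp: xmask_def pauli_defs\<close>)
  also have "\<dots> = (\<Prod>k<n. of_bool (qbit n i k = qbit n a k))"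
  proof (rule prod.cong[OF refl])
    fix k assume "k \<in> {..<n}"
    then show "xmask n a ! k $$ (qbit n i k, qbit n 0 k) = of_bool (qbit n i k = qbit n a k)"
      using qbit_cases[of n i k] qbit_cases[of n a k] by (auto simp: xmask_def pauli_defs)
  qed
  also have "\<dots> = of_bool (i = a)"
    using qbit_ext[OF assms] by (simp only: prod_of_bool finite_lessThan Ball_def lessThan_iff)
  finally show ?thesis .
qed

text \<open>Conjugating |0...0><0...0| sees only the first column of \<open>U\<close>, so a pure
  stabilizer state is the outer product of that column with itself.\<close>

lemma pure_stab_column:
  assumes U: "clifford n U" and col: "\<And>i. i < 2^n \<Longrightarrow> U $$ (i,0) = u i"
  shows "mat (2^n) (2^n) (\<lambda>(a,b). u a * cnj (u b)) \<in> pure_stab n"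
    and "U * ket0_proj n * adj U = mat (2^n) (2^n) (\<lambda>(a,b). u a * cnj (u b))"
proof -
  have Uc: "U \<in> carrier_mat (2^n) (2^n)" using U by (simp add: clifford_def unitary_def)
  have kc: "ket0_proj n \<in> carrier_mat (2^n) (2^n)" by (simp add: ket0_proj_def)
  show eq: "U * ket0_proj n * adj U = mat (2^n) (2^n) (\<lambda>(a,b). u a * cnj (u b))"
  proof (rule eq_matI; clarsimp simp: adj_def)
    fix a b :: nat assume a: "a < 2^n" and b: "b < 2^n"
    have 1: "(U * ket0_proj n) $$ (a,k) = of_bool (k = 0) * u a" if "k < 2^n" for k
    proof -
      have "(U * ket0_proj n) $$ (a,k) = (\<Sum>l<2^n. U $$ (a,l) * ket0_proj n $$ (l,k))"
        by (rule mult_mat_index[OF Uc kc a that])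
      also have "\<dots> = (\<Sum>l<2^n::nat. if l = 0 then U $$ (a,0) * of_bool (k = 0) else 0)"
        using that by (intro sum.cong) (auto simp: ket0_proj_def)
      finally show ?thesis using a by (simp add: col)
    qed
    have "(U * ket0_proj n * adj U) $$ (a,b) = (\<Sum>k<2^n. (U * ket0_proj n) $$ (a,k) * adj U $$ (k,b))"
      by (rule mult_mat_index[OF mult_carrier_mat[OF Uc kc] adj_carrier[OF Uc] a b])
    also have "\<dots> = (\<Sum>k<2^n::nat. if k = 0 then u a * cnj (u b) else 0)"
      using b by (intro sum.cong) (auto simp: 1 adj_index[OF Uc] col)
    finally show "(U * ket0_proj n * mat (dim_col U) (dim_row U) (\<lambda>(i, j). cnj (U $$ (j, i)))) $$ (a,b)
        = u a * cnj (u b)" by (simp add: adj_def)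
  qed (use Uc in auto)
  then show "mat (2^n) (2^n) (\<lambda>(a,b). u a * cnj (u b)) \<in> pure_stab n"
    unfolding pure_stab_def using U by (metis (mono_tags, lifting) mem_Collect_eq)
qed

lemma basis_state_pure_stab:
  assumes "k < 2^n"
  shows "mat (2^n) (2^n) (\<lambda>(a,b). of_bool (a = k \<and> b = k)) \<in> pure_stab n"
proof -
  have "mat (2^n) (2^n) (\<lambda>(a,b). of_bool (a = k) * cnj (of_bool (b = k))) \<in> pure_stab n"
    by (rule pure_stab_column(1)[OF clifford_pauli_string[OF xmask_pauli[of n k]]])
      (simp add: xmask_column assms)
  moreover have "mat (2^n) (2^n) (\<lambda>(a,b). of_bool (a = k) * cnj (of_bool (b = k)))
      = mat (2^n) (2^n) (\<lambda>(a,b). of_bool (a = k \<and> b = k))"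
    by (rule eq_matI) auto
  ultimately show ?thesis by simp
qed

text \<open>Z on the first qubit and X on all qubits anticommute, so their sum divided by sqrt 2 is
  Clifford. Its first column is the GHZ vector: the Z string contributes |0...0> and the X string
  |1...1>. For \<open>n = 1\<close> this is the Hadamard gate.\<close>

lemma ghz_pure_stab:
  assumes "n \<ge> 1"
  shows "mat (2^n) (2^n) (\<lambda>(a,b). of_bool (a \<in> {0, 2^n - 1} \<and> b \<in> {0, 2^n - 1}) / 2) \<in> pure_stab n"
proof -
  obtain m where n: "n = Suc m" using assms by (cases n) auto
  \<comment> \<open>The identity on the remaining qubits is written as the mask of 0, which makes
    \<open>A\<close> a Pauli string by construction.\<close>
  define A where "A = kron pZ (kron_list (xmask m 0))"
  define B where "B = kron pX (kron_list (xmask m (2^m - 1)))"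
  define h where "h = complex_of_real (1 / sqrt 2)"
  let ?N = "2^n :: nat"
  have m0: "kron_list (xmask m 0) = 1\<^sub>m (2^m)"
  proof -
    have "kron_list (replicate m pI) = 1\<^sub>m (2^m)"
      by (induction m) (simp_all add: pI_def mat2_one kron_one)
    then show ?thesis by (simp add: xmask_def map_replicate_const)
  qed
  have A: "A \<in> pauli_strings n" and B: "B \<in> pauli_strings n"
    using xmask_pauli by (auto simp: A_def B_def n pauli_strings_Suc)
  note Ac = pauli_strings_carrier[OF A] and Bc = pauli_strings_carrier[OF B]
  have Xc: "kron_list (xmask m (2^m - 1)) \<in> carrier_mat (2^m) (2^m)"
    using pauli_strings_carrier[OF xmask_pauli] .
  have ZX: "pX * pZ = -1 \<cdot>\<^sub>m (pZ * pX)" by (simp add: pauli_defs mat2_simps)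
  have ZXc: "pZ \<in> carrier_mat 2 2" "pX \<in> carrier_mat 2 2" by (simp_all add: pauli_defs)
  have AB: "B * A = -1 \<cdot>\<^sub>m (A * B)"
    unfolding A_def B_def m0 kron_mult[OF ZXc(1) one_carrier_mat ZXc(2) Xc]
      kron_mult[OF ZXc(2) Xc ZXc(1) one_carrier_mat] ZX left_mult_one_mat[OF Xc] right_mult_one_mat[OF Xc]
    using kron_smult[of "-1" "pZ * pX" 1 "kron_list (xmask m (2^m - 1))"]
    by (simp only: smult_mat_one mult_1_right)
  define u where "u i = of_bool (i \<in> {0, ?N - 1}) * h" for i :: nat
  have "mat ?N ?N (\<lambda>(a,b). u a * cnj (u b)) \<in> pure_stab n"
  proof (rule pure_stab_column(1)[OF clifford_anticommuting[OF A B AB]])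
    fix i :: nat assume i: "i < ?N"
    have "xmask n (?N - 1) = replicate n pX"
      unfolding xmask_def by (rule nth_equalityI) auto
    moreover have "xmask m (2^m - 1) = replicate m pX"
      unfolding xmask_def by (rule nth_equalityI) auto
    ultimately have "B = kron_list (xmask n (?N - 1))" by (simp add: B_def n)
    then have B0: "B $$ (i,0) = of_bool (i = ?N - 1)" using i by (simp add: xmask_column)
    have "A $$ (i,0) = pZ $$ (i div 2^m, 0) * 1\<^sub>m (2^m) $$ (i mod 2^m, 0)"
      unfolding A_def m0 using i by (subst kron_index[OF ZXc(1) one_carrier_mat]) (auto simp: n)
    also have "\<dots> = of_bool (i = 0)"
    proof (cases "i mod 2^m = 0")
      case True
      have "i div 2^m < 2" using i by (simp add: n less_mult_imp_div_less)
      then have "i div 2^m = 0 \<or> i div 2^m = 1" by auto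
      moreover have "i = 0 \<longleftrightarrow> i div 2^m = 0" using True by (metis div_0 div_mult_mod_eq add_0 mult_0)
      ultimately show ?thesis using True by (auto simp: pauli_defs)
    next
      case False
      moreover from this have "i \<noteq> 0" by (metis mod_0)
      ultimately show ?thesis by simp
    qed
    finally have A0: "A $$ (i,0) = of_bool (i = 0)" .
    have "?N - 1 \<noteq> 0" using one_less_power[of "2::nat" n] n by simp
    then show "(complex_of_real (1 / sqrt 2) \<cdot>\<^sub>m (A + B)) $$ (i,0) = u i"
      using Ac Bc i A0 B0 by (auto simp: u_def h_def)
  qed
  moreover have "h * cnj h = 1/2" unfolding h_def by (simp flip: of_real_mult)
  then have "mat ?N ?N (\<lambda>(a,b). u a * cnj (u b))
      = mat ?N ?N (\<lambda>(a,b). of_bool (a \<in> {0, ?N - 1} \<and> b \<in> {0, ?N - 1}) / 2)"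
    by (intro eq_matI) (auto simp: u_def)
  ultimately show ?thesis by simp
qed

subsection \<open>Amplitudes of pure stabilizer states\<close>

text \<open>The stabilizer group of |0...0>. It is kept as lists rather than matrices so that sums
  over it reindex along cons, without asking whether distinct lists give distinct matrices.\<close>

definition z_strings :: "nat \<Rightarrow> complex mat list set" where
  "z_strings n = {l. length l = n \<and> set l \<subseteq> {pI, pZ}}"

lemma z_strings_Suc: "z_strings (Suc n) = (\<lambda>(p, l). p # l) ` ({pI, pZ} \<times> z_strings n)"
proof (intro equalityI subsetI)
  fix l assume "l \<in> z_strings (Suc n)"
  then show "l \<in> (\<lambda>(p, l). p # l) ` ({pI, pZ} \<times> z_strings n)"
    by (cases l) (auto simp: z_strings_def image_iff)
qed (auto simp: z_strings_def)

lemma z_strings_carrier: "l \<in> z_strings n \<Longrightarrow> kron_list l \<in> carrier_mat (2^n) (2^n)"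
  using kron_list_carrier[of l] paulis_carrier unfolding z_strings_def by blast

lemma z_strings_pauli: "l \<in> z_strings n \<Longrightarrow> kron_list l \<in> pauli_strings n"
  unfolding z_strings_def pauli_strings_def by blast

text \<open>Since |0><0| = (I + Z)/2, this is the expansion of the n-fold tensor power of that
  sum.\<close>

lemma ket0_proj_eq_sum:
  assumes "i < 2^n" "j < 2^n"
  shows "ket0_proj n $$ (i,j) = (\<Sum>l\<in>z_strings n. kron_list l $$ (i,j)) / 2^n"
  using assms
proof (induction n arbitrary: i j)
  case 0
  moreover have "z_strings 0 = {[]}" by (auto simp: z_strings_def)
  ultimately show ?case by (simp add: ket0_proj_def)
next
  case (Suc n)
  let ?a = "i div 2^n" and ?b = "j div 2^n" and ?c = "i mod 2^n" and ?d = "j mod 2^n"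
  have inj: "inj_on (\<lambda>(p::complex mat, l). p # l) X" for X by (auto simp: inj_on_def)
  have IZ: "pI \<noteq> pZ" by (simp add: pauli_defs mat2_eq_iff)
  have "(\<Sum>l\<in>z_strings (Suc n). kron_list l $$ (i,j))
      = (\<Sum>(p,l)\<in>{pI, pZ} \<times> z_strings n. kron p (kron_list l) $$ (i,j))"
    unfolding z_strings_Suc sum.reindex[OF inj] by (intro sum.cong) auto
  also have "\<dots> = (\<Sum>(p,l)\<in>{pI, pZ} \<times> z_strings n. p $$ (?a,?b) * kron_list l $$ (?c,?d))"
  proof (rule sum.cong[OF refl], clarsimp)
    fix p l assume *: "p = pI \<or> p = pZ" "l \<in> z_strings n"
    then have "p \<in> carrier_mat 2 2" by (auto simp: pauli_defs)
    then show "kron p (kron_list l) $$ (i,j) = p $$ (?a,?b) * kron_list l $$ (?c,?d)"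
      using Suc.prems by (intro kron_index[OF _ z_strings_carrier[OF *(2)]]) auto
  qed
  also have "\<dots> = (\<Sum>p\<in>{pI, pZ}. p $$ (?a,?b)) * (\<Sum>l\<in>z_strings n. kron_list l $$ (?c,?d))"
    by (simp only: sum_product sum.cartesian_product)
  also have "(\<Sum>p\<in>{pI, pZ}. p $$ (?a,?b)) = 2 * of_bool (?a = 0 \<and> ?b = 0)"
  proof -
    have "?a < 2" "?b < 2" using Suc.prems by (simp_all add: less_mult_imp_div_less)
    then have "?a = 0 \<or> ?a = 1" "?b = 0 \<or> ?b = 1" by auto
    then show ?thesis using IZ by (auto simp: pauli_defs)
  qed
  also have "(\<Sum>l\<in>z_strings n. kron_list l $$ (?c,?d)) = 2^n * ket0_proj n $$ (?c,?d)"
    using Suc.IH[of ?c ?d] by simp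
  also have "ket0_proj n $$ (?c,?d) = of_bool (?c = 0 \<and> ?d = 0)"
    by (simp add: ket0_proj_def)
  finally have "(\<Sum>l\<in>z_strings (Suc n). kron_list l $$ (i,j))
      = 2^Suc n * of_bool ((?a = 0 \<and> ?c = 0) \<and> (?b = 0 \<and> ?d = 0))" by simp
  moreover have "k div 2^n = 0 \<and> k mod 2^n = 0 \<longleftrightarrow> k = 0" for k :: nat
    by (metis div_0 mod_0 div_mult_mod_eq add_0 mult_0)
  ultimately show ?case using Suc.prems by (simp add: ket0_proj_def)
qed

lemma z_strings_column:
  assumes "l \<in> z_strings n" "i < 2^n"
  shows "kron_list l $$ (i,0) = of_bool (i = 0)"
proof -
  have "kron_list l $$ (i,0) = (\<Prod>k<n. l ! k $$ (qbit n i k, qbit n 0 k))"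
    using assms by (intro kron_list_index) (auto simp: z_strings_def pauli_defs)
  also have "\<dots> = (\<Prod>k<n. of_bool (qbit n i k = qbit n 0 k))"
  proof (rule prod.cong[OF refl])
    fix k assume "k \<in> {..<n}"
    then have "l ! k \<in> {pI, pZ}" using assms(1) nth_mem[of k l] unfolding z_strings_def by blast
    then show "l ! k $$ (qbit n i k, qbit n 0 k) = of_bool (qbit n i k = qbit n 0 k)"
      using qbit_cases[of n i k] by (auto simp: pauli_defs)
  qed
  also have "\<dots> = of_bool (i = 0)"
    using qbit_ext[OF assms(2), of 0] by (simp only: prod_of_bool finite_lessThan Ball_def lessThan_iff zero_less_power zero_less_numeral)
  finally show ?thesis .
qed

text \<open>One entry of modulus 1 in each row and zeros elsewhere. Working with moduli makes the
  phases of the Pauli group disappear.\<close>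

definition monomial :: "nat \<Rightarrow> complex mat \<Rightarrow> bool" where
  "monomial d A \<longleftrightarrow> (\<forall>a<d. \<exists>k<d. \<forall>b<d. cmod (A $$ (a,b)) = of_bool (b = k))"

lemma monomial_kron:
  assumes A: "A \<in> carrier_mat d d" "monomial d A" and B: "B \<in> carrier_mat e e" "monomial e B"
  shows "monomial (d * e) (kron A B)"
  unfolding monomial_def
proof (intro allI impI)
  fix a assume a: "a < d * e"
  then have "a div e < d" "a mod e < e" by (simp_all add: div_less_mult mod_less_mult)
  then obtain k l where k: "k < d" "\<And>b. b < d \<Longrightarrow> cmod (A $$ (a div e,b)) = of_bool (b = k)"
    and l: "l < e" "\<And>b. b < e \<Longrightarrow> cmod (B $$ (a mod e,b)) = of_bool (b = l)"
    using A(2) B(2) unfolding monomial_def by meson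
  have "k * e + l < Suc k * e" using l by simp
  also have "\<dots> \<le> d * e" using k(1) by (intro mult_le_mono1) simp
  finally have kl: "k * e + l < d * e" .
  have "cmod (kron A B $$ (a,b)) = of_bool (b = k * e + l)" if b: "b < d * e" for b
  proof -
    have "cmod (kron A B $$ (a,b)) = of_bool (b div e = k) * of_bool (b mod e = l)"
      using a b by (simp add: kron_index[OF A(1) B(1)] norm_mult k(2) l(2) div_less_mult mod_less_mult)
    also have "\<dots> = of_bool (b div e = k \<and> b mod e = l)" by simp
    also have "(b div e = k \<and> b mod e = l) \<longleftrightarrow> b = k * e + l"
      using l(1) by (metis div_mult_mod_eq mod_less mod_mult_self3 div_mult_self3 add_0 div_less
        gr_implies_not0 add.commute)
    finally show ?thesis .
  qed
  with kl show "\<exists>k<d * e. \<forall>b<d * e. cmod (kron A B $$ (a,b)) = of_bool (b = k)" by blast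
qed

lemma monomial_pauli_string: "P \<in> pauli_strings n \<Longrightarrow> monomial (2^n) P"
proof (induction n arbitrary: P)
  case 0
  then show ?case by (auto simp: pauli_strings_0 monomial_def)
next
  case (Suc n)
  then obtain p Q where pQ: "P = kron p Q" "p \<in> paulis" "Q \<in> pauli_strings n"
    by (auto simp: pauli_strings_Suc)
  have "monomial 2 p" using pQ(2) by (auto simp: monomial_def pauli_defs All_less_Suc Ex_less_Suc numeral_2_eq_2)
  moreover have "p \<in> carrier_mat 2 2" using pQ(2) paulis_carrier by blast
  ultimately show ?case
    using monomial_kron[OF _ _ pauli_strings_carrier[OF pQ(3)] Suc.IH[OF pQ(3)]] pQ(1) by simp
qed

lemma monomial_pauli_group: "G \<in> pauli_group n \<Longrightarrow> monomial (2^n) G"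
proof -
  assume "G \<in> pauli_group n"
  then obtain w P where w: "w \<in> phases" "G = w \<cdot>\<^sub>m P" "P \<in> pauli_strings n"
    unfolding pauli_group_def by blast
  have "cmod w = 1" using w(1) by auto
  moreover have "dim_row P = 2^n" "dim_col P = 2^n" using pauli_strings_carrier[OF w(3)] by auto
  ultimately show ?thesis
    using monomial_pauli_string[OF w(3)] unfolding monomial_def w(2) by (simp add: norm_mult)
qed

text \<open>The projector on \<open>|0\<dots>0\<rangle>\<close> is an average of strings \<open>Z\<close>, so if the \<open>(a,b)\<close> entry of
  \<open>U |0\<dots>0\<rangle>\<langle>0\<dots>0| U\<^sup>*\<close> is nonzero then so is that of some \<open>G = U Z U\<^sup>*\<close>.
  This \<open>G\<close> is monomial and fixes the first column of \<open>U\<close>, hence maps its entry \<open>b\<close> to its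
  entry \<open>a\<close> up to a phase.\<close>

lemma clifford_column_flat:
  assumes U: "clifford n U" and a: "a < 2^n" and b: "b < 2^n"
    and nz: "U $$ (a,0) \<noteq> 0" "U $$ (b,0) \<noteq> 0"
  shows "cmod (U $$ (a,0)) = cmod (U $$ (b,0))"
proof -
  let ?N = "2^n :: nat"
  have Uc: "U \<in> carrier_mat ?N ?N" and UU: "adj U * U = 1\<^sub>m ?N"
    using U by (auto simp: clifford_def unitary_def)
  note Ac = adj_carrier[OF Uc]
  have kc: "ket0_proj n \<in> carrier_mat ?N ?N" by (simp add: ket0_proj_def)
  have "(U * ket0_proj n * adj U) $$ (a,b)
      = (\<Sum>k<?N. \<Sum>l<?N. (\<Sum>z\<in>z_strings n. U $$ (a,l) * kron_list z $$ (l,k) * cnj (U $$ (b,k))) / 2^n)"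
    unfolding conj_index[OF Uc kc a b]
    by (intro sum.cong refl) (simp add: ket0_proj_eq_sum sum_distrib_left sum_distrib_right)
  also have "\<dots> = (\<Sum>z\<in>z_strings n. \<Sum>k<?N. \<Sum>l<?N. U $$ (a,l) * kron_list z $$ (l,k) * cnj (U $$ (b,k))) / 2^n"
    by (simp only: sum_divide_distrib[symmetric] sum.swap[of _ "z_strings n"])
  also have "\<dots> = (\<Sum>z\<in>z_strings n. (U * kron_list z * adj U) $$ (a,b)) / 2^n"
    by (simp add: conj_index[OF Uc _ a b] z_strings_carrier)
  finally have eq: "(U * ket0_proj n * adj U) $$ (a,b)
      = (\<Sum>z\<in>z_strings n. (U * kron_list z * adj U) $$ (a,b)) / 2^n" .
  have "(U * ket0_proj n * adj U) $$ (a,b) \<noteq> 0"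
    using pure_stab_column(2)[OF U refl] nz a b by simp
  then have "\<exists>z\<in>z_strings n. (U * kron_list z * adj U) $$ (a,b) \<noteq> 0"
    using eq sum.neutral by fastforce
  then obtain z where z: "z \<in> z_strings n" "(U * kron_list z * adj U) $$ (a,b) \<noteq> 0" by blast
  define G where "G = U * kron_list z * adj U"
  note zc = z_strings_carrier[OF z(1)]
  have Gc: "G \<in> carrier_mat ?N ?N" unfolding G_def by (rule mult_carrier_mat[OF mult_carrier_mat[OF Uc zc] Ac])
  have "G \<in> pauli_group n"
    unfolding G_def using U pauli_group_string[OF z_strings_pauli[OF z(1)]] by (simp add: clifford_def)
  from monomial_pauli_group[OF this] obtain k
    where k: "\<And>j. j < ?N \<Longrightarrow> cmod (G $$ (a,j)) = of_bool (j = k)"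
    unfolding monomial_def using a by blast
  have "k = b" using k[OF b] z(2) unfolding G_def by (metis norm_eq_zero of_bool_eq(1))
  have "G * U = U * kron_list z * (adj U * U)"
    unfolding G_def by (rule assoc_mult_mat[OF mult_carrier_mat[OF Uc zc] Ac Uc])
  also have "\<dots> = U * kron_list z"
    using right_mult_one_mat[OF mult_carrier_mat[OF Uc zc]] by (simp add: UU)
  finally have GU: "G * U = U * kron_list z" .
  have "U $$ (a,0) = (\<Sum>j<?N. if j = 0 then U $$ (a,0) else 0)" using a by simp
  also have "\<dots> = (\<Sum>j<?N. U $$ (a,j) * kron_list z $$ (j,0))"
    by (intro sum.cong refl) (simp add: z_strings_column[OF z(1)])
  also have "\<dots> = (G * U) $$ (a,0)"
    unfolding GU by (rule mult_mat_index[symmetric, OF Uc zc a]) simp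
  also have "\<dots> = (\<Sum>j<?N. G $$ (a,j) * U $$ (j,0))"
    by (rule mult_mat_index[OF Gc Uc a]) simp
  also have "\<dots> = (\<Sum>j<?N. if j = b then G $$ (a,b) * U $$ (b,0) else 0)"
  proof (intro sum.cong refl)
    fix j assume "j \<in> {..<?N}"
    then show "G $$ (a,j) * U $$ (j,0) = (if j = b then G $$ (a,b) * U $$ (b,0) else 0)"
      using k[of j] \<open>k = b\<close> by auto
  qed
  also have "\<dots> = G $$ (a,b) * U $$ (b,0)" using b by simp
  finally show ?thesis using k[OF b] \<open>k = b\<close> by (simp add: norm_mult)
qed

lemma pure_stabE:
  assumes "\<sigma> \<in> pure_stab n"
  obtains u where "\<sigma> = mat (2^n) (2^n) (\<lambda>(a,b). u a * cnj (u b))" "(\<Sum>a<2^n. (cmod (u a))\<^sup>2) = 1"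
    "\<And>a b. a < 2^n \<Longrightarrow> b < 2^n \<Longrightarrow> u a \<noteq> 0 \<Longrightarrow> u b \<noteq> 0 \<Longrightarrow> cmod (u a) = cmod (u b)"
proof -
  obtain U where U: "clifford n U" "\<sigma> = U * ket0_proj n * adj U"
    using assms unfolding pure_stab_def by blast
  define u where "u i = U $$ (i,0)" for i
  have Uc: "U \<in> carrier_mat (2^n) (2^n)" and UU: "adj U * U = 1\<^sub>m (2^n)"
    using U(1) by (auto simp: clifford_def unitary_def)
  have "1 = (adj U * U) $$ (0,0)" by (simp add: UU)
  also have "\<dots> = (\<Sum>k<2^n. adj U $$ (0,k) * U $$ (k,0))"
    by (rule mult_mat_index[OF adj_carrier[OF Uc] Uc]) simp_all
  also have "\<dots> = (\<Sum>k<2^n. complex_of_real ((cmod (u k))\<^sup>2))"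
    by (intro sum.cong refl) (simp add: adj_index[OF Uc] u_def complex_norm_square mult.commute del: of_real_power)
  finally have sum: "(\<Sum>k<2^n. (cmod (u k))\<^sup>2) = 1" by (metis of_real_sum of_real_eq_1_iff)
  have \<sigma>: "\<sigma> = mat (2^n) (2^n) (\<lambda>(a,b). u a * cnj (u b))"
    unfolding U(2) by (rule pure_stab_column(2)[OF U(1)]) (simp add: u_def)
  show ?thesis
    by (rule that[OF \<sigma> sum clifford_column_flat[OF U(1), folded u_def]])
qed

subsection \<open>Robustness of GHZ-diagonal states\<close>

text \<open>If one of the two amplitudes vanishes, the entry at (a,b) is 0 and the diagonal entry at
  b lies in [0,1]. Otherwise both amplitudes have the same modulus r: the entry at (a,b) has modulus
  r^2, which is the diagonal entry, and normalization gives 2 r^2 <= 1.\<close>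

lemma pure_stab_bounds:
  assumes \<sigma>: "\<sigma> \<in> pure_stab n" and a: "a < 2^n" and b: "b < 2^n" and ab: "a \<noteq> b"
  shows "(\<Sum>i<2^n. Re (\<sigma> $$ (i,i))) = 1"
    and "Re (\<sigma> $$ (a,b)) \<le> Re (\<sigma> $$ (b,b))"
    and "Re (\<sigma> $$ (b,b)) - 1 \<le> Re (\<sigma> $$ (a,b))"
proof -
  obtain u where u: "\<sigma> = mat (2^n) (2^n) (\<lambda>(a,b). u a * cnj (u b))" "(\<Sum>a<2^n. (cmod (u a))\<^sup>2) = 1"
    and flat: "\<And>a b. a < 2^n \<Longrightarrow> b < 2^n \<Longrightarrow> u a \<noteq> 0 \<Longrightarrow> u b \<noteq> 0 \<Longrightarrow> cmod (u a) = cmod (u b)"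
    using pure_stabE[OF \<sigma>] by blast
  have diag: "Re (\<sigma> $$ (i,i)) = (cmod (u i))\<^sup>2" if "i < 2^n" for i
    using that by (simp add: u(1) cmod_power2) (simp add: power2_eq_square)
  show "(\<Sum>i<2^n. Re (\<sigma> $$ (i,i))) = 1"
    using u(2) diag by simp
  have off: "\<sigma> $$ (a,b) = u a * cnj (u b)" using a b by (simp add: u(1))
  have "(\<Sum>i\<in>{a,b}. (cmod (u i))\<^sup>2) \<le> (\<Sum>a<2^n. (cmod (u a))\<^sup>2)"
    using a b by (intro sum_mono2) auto
  then have le: "(cmod (u a))\<^sup>2 + (cmod (u b))\<^sup>2 \<le> 1" using ab u(2) by simp
  have "Re (\<sigma> $$ (a,b)) \<le> Re (\<sigma> $$ (b,b)) \<and> Re (\<sigma> $$ (b,b)) - 1 \<le> Re (\<sigma> $$ (a,b))"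
  proof (cases "u a = 0 \<or> u b = 0")
    case True
    moreover have "(cmod (u b))\<^sup>2 \<le> 1" using le zero_le_power2[of "cmod (u a)"] by linarith
    ultimately show ?thesis by (auto simp: off diag[OF b])
  next
    case False
    then have "cmod (u a) = cmod (u b)" using flat a b by blast
    moreover have "\<bar>Re (\<sigma> $$ (a,b))\<bar> \<le> cmod (u a) * cmod (u b)"
      using abs_Re_le_cmod[of "\<sigma> $$ (a,b)"] by (simp add: off norm_mult)
    ultimately have "\<bar>Re (\<sigma> $$ (a,b))\<bar> \<le> (cmod (u b))\<^sup>2" "(cmod (u b))\<^sup>2 + (cmod (u b))\<^sup>2 \<le> 1"
      using le by (simp_all add: power2_eq_square)
    then show ?thesis unfolding diag[OF b] by linarith
  qed
  then show "Re (\<sigma> $$ (a,b)) \<le> Re (\<sigma> $$ (b,b))" "Re (\<sigma> $$ (b,b)) - 1 \<le> Re (\<sigma> $$ (a,b))"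
    by simp_all
qed

text \<open>The common form of convex mixtures and of the signed decompositions in the robustness,
  so that linear functionals are pushed through both in the same way.\<close>

definition real_comb :: "nat \<Rightarrow> nat \<Rightarrow> (nat \<Rightarrow> real) \<Rightarrow> (nat \<Rightarrow> complex mat) \<Rightarrow> complex mat" where
  "real_comb n k q \<sigma> = mat (2^n) (2^n) (\<lambda>(a,b). \<Sum>j<k. complex_of_real (q j) * (\<sigma> j) $$ (a,b))"

lemma Re_real_comb: "a < 2^n \<Longrightarrow> b < 2^n \<Longrightarrow>
    Re (real_comb n k q \<sigma> $$ (a,b)) = (\<Sum>j<k. q j * Re (\<sigma> j $$ (a,b)))"
  by (simp add: real_comb_def)

lemma trace_real_comb:
  "(\<Sum>i<2^n. Re (real_comb n k q \<sigma> $$ (i,i))) = (\<Sum>j<k. q j * (\<Sum>i<2^n. Re (\<sigma> j $$ (i,i))))"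
proof -
  have "(\<Sum>i<2^n. Re (real_comb n k q \<sigma> $$ (i,i))) = (\<Sum>i<2^n. \<Sum>j<k. q j * Re (\<sigma> j $$ (i,i)))"
    by (intro sum.cong refl Re_real_comb) auto
  also have "\<dots> = (\<Sum>j<k. q j * (\<Sum>i<2^n. Re (\<sigma> j $$ (i,i))))"
    by (subst sum.swap) (simp add: sum_distrib_left)
  finally show ?thesis .
qed

lemma stab_polytope_eq:
  "stab_polytope n = {real_comb n k p \<sigma> | k p \<sigma>. (\<forall>j<k. p j \<ge> 0 \<and> \<sigma> j \<in> pure_stab n) \<and> (\<Sum>j<k. p j) = 1}"
  unfolding stab_polytope_def real_comb_def ..

lemma robustness_eq:
  "robustness n \<rho> = Inf {(\<Sum>j<k. \<bar>q j\<bar>) | k q \<sigma>. (\<forall>j<k. \<sigma> j \<in> stab_polytope n) \<and> \<rho> = real_comb n k q \<sigma>}"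
  unfolding robustness_def real_comb_def ..

lemma stab_polytope_bounds:
  assumes \<sigma>: "\<sigma> \<in> stab_polytope n" and a: "a < 2^n" and b: "b < 2^n" and ab: "a \<noteq> b"
  shows "(\<Sum>i<2^n. Re (\<sigma> $$ (i,i))) = 1"
    and "Re (\<sigma> $$ (a,b)) \<le> Re (\<sigma> $$ (b,b))"
    and "Re (\<sigma> $$ (b,b)) - 1 \<le> Re (\<sigma> $$ (a,b))"
proof -
  obtain k p \<tau> where *: "\<sigma> = real_comb n k p \<tau>" "\<And>j. j < k \<Longrightarrow> p j \<ge> 0"
    "\<And>j. j < k \<Longrightarrow> \<tau> j \<in> pure_stab n" "(\<Sum>j<k. p j) = 1"
    using \<sigma> unfolding stab_polytope_eq by blast
  note pure = pure_stab_bounds[OF *(3) a b ab]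
  show "(\<Sum>i<2^n. Re (\<sigma> $$ (i,i))) = 1"
    using *(4) pure(1) by (simp add: *(1) trace_real_comb)
  show "Re (\<sigma> $$ (a,b)) \<le> Re (\<sigma> $$ (b,b))"
    unfolding *(1) Re_real_comb[OF a b] Re_real_comb[OF b b]
    by (intro sum_mono mult_left_mono) (use pure *(2) in auto)
  \<comment> \<open>The constant 1 is the sum of the weights, which turns the affine bound into a
    termwise one.\<close>
  have "(\<Sum>j<k. p j * Re (\<tau> j $$ (b,b))) - (\<Sum>j<k. p j) = (\<Sum>j<k. p j * (Re (\<tau> j $$ (b,b)) - 1))"
    by (simp add: sum_subtractf right_diff_distrib)
  also have "\<dots> \<le> (\<Sum>j<k. p j * Re (\<tau> j $$ (a,b)))"
    by (intro sum_mono mult_left_mono) (use pure *(2) in auto)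
  finally show "Re (\<sigma> $$ (b,b)) - 1 \<le> Re (\<sigma> $$ (a,b))"
    unfolding *(1) Re_real_comb[OF a b] Re_real_comb[OF b b] using *(4) by simp
qed

text \<open>The functional \<open>\<sigma> \<mapsto> tr \<sigma> + 2 Re (\<sigma>\<^sub>a\<^sub>b - \<sigma>\<^sub>b\<^sub>b)\<close> is a dual witness: it takes values
  in \<open>[-1,1]\<close> on the stabilizer polytope.\<close>

lemma real_comb_witness:
  fixes q :: "nat \<Rightarrow> real"
  assumes \<sigma>: "\<And>j. j < k \<Longrightarrow> \<sigma> j \<in> stab_polytope n" and a: "a < 2^n" and b: "b < 2^n" and ab: "a \<noteq> b"
  defines "\<rho> \<equiv> real_comb n k q \<sigma>"
  shows "(\<Sum>i<2^n. Re (\<rho> $$ (i,i))) \<le> (\<Sum>j<k. \<bar>q j\<bar>)"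
    and "(\<Sum>i<2^n. Re (\<rho> $$ (i,i))) + 2 * (Re (\<rho> $$ (a,b)) - Re (\<rho> $$ (b,b))) \<le> (\<Sum>j<k. \<bar>q j\<bar>)"
proof -
  note bd = stab_polytope_bounds[OF \<sigma> a b ab]
  \<comment> \<open>Each \<open>\<sigma> j\<close> has trace 1, so the trace of
    \<open>\<rho>\<close> is the sum of the coefficients. Taking the trace as the constant part
    makes the witness linear.\<close>
  have tr: "(\<Sum>i<2^n. Re (\<rho> $$ (i,i))) = (\<Sum>j<k. q j)"
    using bd(1) by (simp add: \<rho>_def trace_real_comb)
  show "(\<Sum>i<2^n. Re (\<rho> $$ (i,i))) \<le> (\<Sum>j<k. \<bar>q j\<bar>)"
    unfolding tr by (intro sum_mono) simp
  have "(\<Sum>i<2^n. Re (\<rho> $$ (i,i))) + 2 * (Re (\<rho> $$ (a,b)) - Re (\<rho> $$ (b,b)))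
      = (\<Sum>j<k. q j * (1 + 2 * (Re (\<sigma> j $$ (a,b)) - Re (\<sigma> j $$ (b,b)))))"
    unfolding tr unfolding \<rho>_def Re_real_comb[OF a b] Re_real_comb[OF b b]
    by (simp add: sum.distrib sum_subtractf sum_distrib_left algebra_simps)
  also have "\<dots> \<le> (\<Sum>j<k. \<bar>q j\<bar> * 1)"
  proof (rule sum_mono)
    fix j assume "j \<in> {..<k}"
    \<comment> \<open>The difference of the two real parts lies in [-1,0].\<close>
    then have "\<bar>1 + 2 * (Re (\<sigma> j $$ (a,b)) - Re (\<sigma> j $$ (b,b)))\<bar> \<le> 1"
      using bd(2,3)[of j] by auto
    then have "\<bar>q j * (1 + 2 * (Re (\<sigma> j $$ (a,b)) - Re (\<sigma> j $$ (b,b))))\<bar> \<le> \<bar>q j\<bar> * 1"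
      unfolding abs_mult by (intro mult_left_mono) auto
    then show "q j * (1 + 2 * (Re (\<sigma> j $$ (a,b)) - Re (\<sigma> j $$ (b,b)))) \<le> \<bar>q j\<bar> * 1" by linarith
  qed
  finally show "(\<Sum>i<2^n. Re (\<rho> $$ (i,i))) + 2 * (Re (\<rho> $$ (a,b)) - Re (\<rho> $$ (b,b))) \<le> (\<Sum>j<k. \<bar>q j\<bar>)"
    by simp
qed

lemma pure_stab_subset_polytope: "pure_stab n \<subseteq> stab_polytope n"
proof
  fix \<sigma> assume \<sigma>: "\<sigma> \<in> pure_stab n"
  then have "\<sigma> \<in> carrier_mat (2^n) (2^n)"
    by (auto simp: pure_stab_def clifford_def unitary_def adj_def)
  then have "\<sigma> = real_comb n 1 (\<lambda>_. 1) (\<lambda>_. \<sigma>)"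
    by (intro eq_matI) (auto simp: real_comb_def)
  then show "\<sigma> \<in> stab_polytope n"
    unfolding stab_polytope_eq using \<sigma>
    by (intro CollectI exI[of _ 1] exI[of _ "\<lambda>_. 1"] exI[of _ "\<lambda>_. \<sigma>"]) simp
qed

text \<open>For \<open>n = 1\<close> the extreme indices are 0 and 1, and this is an arbitrary real
  symmetric 2 x 2 matrix; the one-qubit output is thus an instance.\<close>

definition ghz_diag :: "nat \<Rightarrow> (nat \<Rightarrow> real) \<Rightarrow> real \<Rightarrow> complex mat" where
  "ghz_diag n d c = mat (2^n) (2^n) (\<lambda>(a,b). complex_of_real
     (if a = b then d a else if a \<in> {0, 2^n - 1} \<and> b \<in> {0, 2^n - 1} then c else 0))"

text \<open>The assumption \<open>c_le\<close> leaves at most one of \<open>d 0 - c\<close> and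
  \<open>d (2^n - 1) - c\<close> negative. This is what makes the decomposition below
  optimal.\<close>

locale ghz_diag_state =
  fixes n :: nat and d :: "nat \<Rightarrow> real" and c :: real
  assumes n: "n \<ge> 1" and d_nonneg: "\<And>a. a < 2^n \<Longrightarrow> d a \<ge> 0" and d_sum: "(\<Sum>a<2^n. d a) = 1"
    and c_nonneg: "c \<ge> 0" and c_le: "c \<le> max (d 0) (d (2^n - 1))"
begin

abbreviation "N \<equiv> 2^n - 1 :: nat"

lemmas N = top_index(1)[OF n] top_index(2)[of n]

text \<open>Twice the coherence as weight of the GHZ state, the remaining diagonal as weights of the
  basis states.\<close>

definition wt :: "nat \<Rightarrow> real" where
  "wt j = (if j = 2^n then 2 * c else d j - (if j \<in> {0, N} then c else 0))"

definition \<tau> :: "nat \<Rightarrow> complex mat" where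
  "\<tau> j = (if j = 2^n then mat (2^n) (2^n) (\<lambda>(a,b). of_bool (a \<in> {0, N} \<and> b \<in> {0, N}) / 2)
     else mat (2^n) (2^n) (\<lambda>(a,b). of_bool (a = j \<and> b = j)))"

lemma \<tau>_pure: "j < Suc (2^n) \<Longrightarrow> \<tau> j \<in> pure_stab n"
  unfolding \<tau>_def using ghz_pure_stab[OF n] basis_state_pure_stab[of j n] by simp

text \<open>The GHZ state with weight \<open>2 * c\<close> puts \<open>c\<close> on all four corner
  entries, which is exactly what \<open>wt\<close> takes off the two corner diagonal
  entries.\<close>

lemma decomposition: "ghz_diag n d c = real_comb n (Suc (2^n)) wt \<tau>"
proof (rule eq_matI)
  fix a b assume "a < dim_row (real_comb n (Suc (2^n)) wt \<tau>)" "b < dim_col (real_comb n (Suc (2^n)) wt \<tau>)"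
  then have a: "a < 2^n" and b: "b < 2^n" by (auto simp: real_comb_def)
  have "real_comb n (Suc (2^n)) wt \<tau> $$ (a,b)
      = (\<Sum>j<2^n. complex_of_real (wt j) * \<tau> j $$ (a,b)) + complex_of_real (wt (2^n)) * \<tau> (2^n) $$ (a,b)"
    using a b by (simp add: real_comb_def)
  also have "(\<Sum>j<2^n. complex_of_real (wt j) * \<tau> j $$ (a,b))
      = (\<Sum>j<2^n. if j = a then of_bool (a = b) * complex_of_real (wt a) else 0)"
    using a b by (intro sum.cong) (auto simp: \<tau>_def)
  also have "\<dots> = of_bool (a = b) * complex_of_real (wt a)" using a by simp
  also have "complex_of_real (wt (2^n)) * \<tau> (2^n) $$ (a,b)
      = (if a \<in> {0, N} \<and> b \<in> {0, N} then complex_of_real c else 0)"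
    using a b by (simp add: wt_def \<tau>_def)
  finally have "real_comb n (Suc (2^n)) wt \<tau> $$ (a,b) = of_bool (a = b) * complex_of_real (wt a)
      + (if a \<in> {0, N} \<and> b \<in> {0, N} then complex_of_real c else 0)" .
  then show "ghz_diag n d c $$ (a,b) = real_comb n (Suc (2^n)) wt \<tau> $$ (a,b)"
    using a b by (auto simp: ghz_diag_def wt_def simp del: One_nat_def)
qed (auto simp: ghz_diag_def real_comb_def)

lemma sum_0N: "(\<Sum>a<2^n. if a \<in> {0, N} then f a else 0) = f 0 + f N" for f :: "nat \<Rightarrow> real"
  by (subst sum_two[OF _ N]) auto

lemma wt_sum: "(\<Sum>j<Suc (2^n). wt j) = 1"
proof -
  have "(\<Sum>j<Suc (2^n). wt j) = (\<Sum>j<2^n. d j - (if j \<in> {0, N} then c else 0)) + 2 * c"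
    by (simp add: wt_def)
  then show ?thesis using sum_0N[of "\<lambda>_. c"] d_sum by (simp add: sum_subtractf)
qed

lemma wt_abs_sum: "(\<Sum>j<Suc (2^n). \<bar>wt j\<bar>) = 1 + 2 * max 0 (c - min (d 0) (d N))"
proof -
  \<comment> \<open>Twice the negative part of \<open>d j - c\<close>. All other weights are
    nonnegative, so only the two corners can contribute to the excess.\<close>
  let ?e = "\<lambda>j. \<bar>d j - c\<bar> - (d j - c)"
  have "(\<Sum>j<Suc (2^n). \<bar>wt j\<bar>) = (\<Sum>j<Suc (2^n). wt j) + (\<Sum>j<Suc (2^n). \<bar>wt j\<bar> - wt j)"
    by (simp add: sum_subtractf)
  also have "(\<Sum>j<Suc (2^n). \<bar>wt j\<bar> - wt j) = (\<Sum>j<2^n. if j \<in> {0, N} then ?e j else 0)"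
    using c_nonneg d_nonneg by (auto simp: wt_def intro!: sum.cong)
  also have "\<dots> = ?e 0 + ?e N" by (rule sum_0N)
  \<comment> \<open>By \<open>c_le\<close> at most one of the two terms is nonzero, the one at the
    smaller diagonal entry.\<close>
  also have "\<dots> = 2 * max 0 (c - min (d 0) (d N))"
    using c_le by (auto simp: max_def min_def abs_if split: if_splits)
  finally show ?thesis unfolding wt_sum .
qed

lemma trace_ghz_diag: "(\<Sum>i<2^n. Re (ghz_diag n d c $$ (i,i))) = 1"
  using d_sum by (simp add: ghz_diag_def)

lemma ghz_diag_entries:
  "Re (ghz_diag n d c $$ (0,N)) = c" "Re (ghz_diag n d c $$ (N,0)) = c"
  "Re (ghz_diag n d c $$ (0,0)) = d 0" "Re (ghz_diag n d c $$ (N,N)) = d N"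
  using N by (auto simp: ghz_diag_def)

text \<open>Necessity is the entry bound at the corners (0,N) and (N,0). Conversely, if
  \<open>c\<close> is at most both diagonal entries, all weights are nonnegative and the
  decomposition is a convex mixture.\<close>

lemma mem_stab_polytope_iff: "ghz_diag n d c \<in> stab_polytope n \<longleftrightarrow> c \<le> min (d 0) (d N)"
proof
  assume "ghz_diag n d c \<in> stab_polytope n"
  then show "c \<le> min (d 0) (d N)"
    using stab_polytope_bounds(2)[of "ghz_diag n d c" n 0 N] stab_polytope_bounds(2)[of "ghz_diag n d c" n N 0] N
    unfolding ghz_diag_entries by simp
next
  assume "c \<le> min (d 0) (d N)"
  then have "\<forall>j<Suc (2^n). wt j \<ge> 0"
    using c_nonneg d_nonneg by (auto simp: wt_def)
  then show "ghz_diag n d c \<in> stab_polytope n"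
    unfolding stab_polytope_eq decomposition using \<tau>_pure wt_sum by blast
qed

text \<open>The infimum is attained by the decomposition above. For the lower bound, the trace gives
  the alternative 0 in the maximum, and the witness with b = N and with b = 0 gives
  \<open>c - d N\<close> and \<open>c - d 0\<close>.\<close>

lemma robustness_ghz_diag: "robustness n (ghz_diag n d c) = 1 + 2 * max 0 (c - min (d 0) (d N))"
  unfolding robustness_eq
proof (rule cInf_eq_minimum)
  show "1 + 2 * max 0 (c - min (d 0) (d N)) \<in> {\<Sum>j<k. \<bar>q j\<bar> | k q \<sigma>.
      (\<forall>j<k. \<sigma> j \<in> stab_polytope n) \<and> ghz_diag n d c = real_comb n k q \<sigma>}"
    using decomposition wt_abs_sum \<tau>_pure pure_stab_subset_polytope
    by (intro CollectI exI[of _ "Suc (2^n)"] exI[of _ wt] exI[of _ \<tau>]) auto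
next
  fix x assume "x \<in> {\<Sum>j<k. \<bar>q j\<bar> | k q \<sigma>.
      (\<forall>j<k. \<sigma> j \<in> stab_polytope n) \<and> ghz_diag n d c = real_comb n k q \<sigma>}"
  then obtain k r \<sigma> where x: "x = (\<Sum>j<k. \<bar>r j\<bar>)" and \<sigma>: "\<And>j. j < k \<Longrightarrow> \<sigma> j \<in> stab_polytope n"
    and eq: "ghz_diag n d c = real_comb n k r \<sigma>" by blast
  have N0: "0 < (2^n :: nat)" by simp
  show "1 + 2 * max 0 (c - min (d 0) (d N)) \<le> x"
    using real_comb_witness[where k = k and \<sigma> = \<sigma> and q = r, OF \<sigma> N0 N(2) N(1)[symmetric]]
      real_comb_witness(2)[where k = k and \<sigma> = \<sigma> and q = r, OF \<sigma> N(2) N0 N(1)]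
    unfolding x eq[symmetric] trace_ghz_diag ghz_diag_entries by (auto simp: max_def min_def)
qed

end

subsection \<open>Amplitude damping of the generalized GHZ state\<close>

text \<open>The only choice of Kraus operators that takes \<open>|1\<dots>1\<rangle>\<close> to a multiple of \<open>|a\<rangle>\<close>, and the
  amplitude with which it does so.\<close>

definition flip_pattern :: "nat \<Rightarrow> nat \<Rightarrow> bool list" where
  "flip_pattern n a = map (\<lambda>k. qbit n a k = 0) [0..<n]"

definition flip_amp :: "real \<Rightarrow> nat \<Rightarrow> nat \<Rightarrow> real" where
  "flip_amp \<gamma> n a = (\<Prod>k<n. sqrt (if qbit n a k = 0 then \<gamma> else 1 - \<gamma>))"

lemma length_flip_pattern [simp]: "length (flip_pattern n a) = n"
  by (simp add: flip_pattern_def)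

lemma flip_pattern_eq_iff:
  assumes "a < 2^n" "b < 2^n" shows "flip_pattern n a = flip_pattern n b \<longleftrightarrow> a = b"
proof -
  have "qbit n a k = qbit n b k" if "(qbit n a k = 0) = (qbit n b k = 0)" for k
    using that qbit_cases[of n a k] qbit_cases[of n b k] by auto
  then show ?thesis
    unfolding qbit_ext[OF assms, symmetric] by (auto simp: flip_pattern_def list_eq_iff_nth_eq)
qed

lemma flip_pattern_top: "flip_pattern n (2^n - 1) = replicate n False"
  by (rule nth_equalityI) (auto simp: flip_pattern_def)

lemma flip_amp_top: "flip_amp \<gamma> n (2^n - 1) = sqrt ((1 - \<gamma>)^n)"
  by (simp add: flip_amp_def real_sqrt_power)

lemma ad_kraus_carrier: "ad_kraus \<gamma> b \<in> carrier_mat 2 2"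
  by (simp add: ad_kraus_def)

text \<open>The no-decay operator fixes |0> and the decay operator annihilates it, so only the
  pattern without any decay survives.\<close>

lemma ad_kraus_column_0:
  assumes "length bs = n" "a < 2^n"
  shows "kron_list (map (ad_kraus \<gamma>) bs) $$ (a,0) = of_bool (a = 0 \<and> bs = replicate n False)"
proof -
  have "kron_list (map (ad_kraus \<gamma>) bs) $$ (a,0)
      = (\<Prod>k<n. map (ad_kraus \<gamma>) bs ! k $$ (qbit n a k, qbit n 0 k))"
    using assms ad_kraus_carrier by (intro kron_list_index) auto
  also have "\<dots> = (\<Prod>k<n. of_bool (qbit n a k = qbit n 0 k \<and> bs ! k = False))"
  proof (rule prod.cong[OF refl])
    fix k assume "k \<in> {..<n}"
    then show "map (ad_kraus \<gamma>) bs ! k $$ (qbit n a k, qbit n 0 k)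
        = of_bool (qbit n a k = qbit n 0 k \<and> bs ! k = False)"
      using assms(1) qbit_cases[of n a k] by (auto simp: ad_kraus_def)
  qed
  also have "\<dots> = of_bool ((\<forall>k<n. qbit n a k = qbit n 0 k) \<and> (\<forall>k<n. bs ! k = False))"
    by (subst prod_of_bool) auto
  also have "(\<forall>k<n. qbit n a k = qbit n 0 k) \<longleftrightarrow> a = 0"
    using assms by (intro qbit_ext) auto
  also have "(\<forall>k<n. bs ! k = False) \<longleftrightarrow> bs = replicate n False"
    using assms(1) by (auto simp: list_eq_iff_nth_eq)
  finally show ?thesis .
qed

lemma ad_kraus_column_top:
  assumes "length bs = n" "a < 2^n"
  shows "kron_list (map (ad_kraus \<gamma>) bs) $$ (a,2^n - 1)
    = of_bool (bs = flip_pattern n a) * complex_of_real (flip_amp \<gamma> n a)"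
proof -
  have "kron_list (map (ad_kraus \<gamma>) bs) $$ (a,2^n - 1)
      = (\<Prod>k<n. map (ad_kraus \<gamma>) bs ! k $$ (qbit n a k, qbit n (2^n - 1) k))"
    using assms ad_kraus_carrier top_index(2)[of n] by (intro kron_list_index) auto
  also have "\<dots> = (\<Prod>k<n. of_bool (bs ! k = (qbit n a k = 0))
      * complex_of_real (sqrt (if qbit n a k = 0 then \<gamma> else 1 - \<gamma>)))"
  proof (rule prod.cong[OF refl])
    fix k assume "k \<in> {..<n}"
    then show "map (ad_kraus \<gamma>) bs ! k $$ (qbit n a k, qbit n (2^n - 1) k)
        = of_bool (bs ! k = (qbit n a k = 0))
          * complex_of_real (sqrt (if qbit n a k = 0 then \<gamma> else 1 - \<gamma>))"
      using assms(1) qbit_cases[of n a k] by (auto simp: ad_kraus_def)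
  qed
  also have "\<dots> = of_bool (\<forall>k<n. bs ! k = (qbit n a k = 0)) * complex_of_real (flip_amp \<gamma> n a)"
    unfolding prod.distrib flip_amp_def of_real_prod by (subst prod_of_bool) auto
  also have "(\<forall>k<n. bs ! k = (qbit n a k = 0)) \<longleftrightarrow> bs = flip_pattern n a"
    using assms(1) by (auto simp: list_eq_iff_nth_eq flip_pattern_def)
  finally show ?thesis .
qed

text \<open>Trace preservation on |1...1>: the squared amplitudes are products of \<gamma> for each
  bit 0 and 1 - \<gamma> for each bit 1, and their sum is a product of factors \<gamma> + (1 -
  \<gamma>).\<close>

lemma sum_flip_amp_square:
  assumes "0 \<le> \<gamma>" "\<gamma> \<le> 1"
  shows "(\<Sum>a<2^n. (flip_amp \<gamma> n a)\<^sup>2) = 1"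
proof -
  define w where "w j = (if j = (0::nat) then \<gamma> else 1 - \<gamma>)" for j
  have sq: "(flip_amp \<gamma> n a)\<^sup>2 = (\<Prod>k<n. w (qbit n a k))" for n a
    unfolding flip_amp_def prod_power_distrib w_def using assms by (intro prod.cong) auto
  have "(\<Sum>a<2^n. \<Prod>k<n. w (qbit n a k)) = 1"
  proof (induction n)
    case (Suc n)
    have "(\<Sum>a<2^Suc n. \<Prod>k<Suc n. w (qbit (Suc n) a k))
        = (\<Sum>a<2*2^n. w (a div 2^n) * (\<Prod>k<n. w (qbit n (a mod 2^n) k)))"
      by (intro sum.cong) (auto simp: prod.lessThan_Suc_shift qbit_Suc_0 qbit_Suc_Suc simp del: prod.lessThan_Suc)
    also have "\<dots> = (\<Sum>i<2. \<Sum>j<2^n. w i * (\<Prod>k<n. w (qbit n j k)))"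
      by (rule sum_div_mod)
    also have "\<dots> = 1"
      by (simp add: sum_distrib_left[symmetric] Suc.IH) (simp add: w_def numeral_2_eq_2)
    finally show ?case .
  qed simp
  then show ?thesis by (simp add: sq)
qed

text \<open>The product of two entries of the damped vector for one Kraus pattern, with the index
  conditions abstracted to propositional variables so that a plain case split proves it.\<close>

lemma of_bool_expand:
  fixes x y g h :: "'a::comm_ring_1"
  shows "(of_bool (A \<and> X) * x + of_bool Y * g * y) * (of_bool (B \<and> X) * x + of_bool Z * h * y)
    = of_bool (A \<and> B \<and> X) * x\<^sup>2 + x * y * (of_bool (A \<and> X \<and> Z) * h + of_bool (B \<and> X \<and> Y) * g)
      + of_bool (Y \<and> Z) * y\<^sup>2 * g * h"
  by (cases A; cases B; cases X; cases Y; cases Z) (simp_all add: algebra_simps power2_eq_square)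

definition rho_diag :: "nat \<Rightarrow> real \<Rightarrow> real \<Rightarrow> real \<Rightarrow> nat \<Rightarrow> real" where
  "rho_diag n \<alpha> \<beta> \<gamma> a = (if a = 0 then \<alpha>\<^sup>2 else 0) + \<beta>\<^sup>2 * (flip_amp \<gamma> n a)\<^sup>2"

text \<open>A Kraus pattern \<open>bs\<close> turns the state vector into \<open>v bs\<close>, whose
  \<alpha> part needs \<open>bs = F\<close> and whose \<beta> part at x needs
  \<open>bs = flip_pattern n x\<close>. As flip patterns are injective, \<beta>^2 terms occur only
  for a = b, and cross terms only between 0 and the index with flip pattern \<open>F\<close>, which
  is the all-ones index.\<close>

lemma rho_n_eq_ghz_diag:
  assumes n: "n \<ge> 1"
  shows "rho_n n \<alpha> \<beta> \<gamma> = ghz_diag n (rho_diag n \<alpha> \<beta> \<gamma>) (cc n \<alpha> \<beta> \<gamma>)"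
proof (rule eq_matI)
  let ?N = "2^n - 1 :: nat"
  note N = top_index(1)[OF n] top_index(2)[of n]
  define amp where "amp k = (if k = 0 then complex_of_real \<alpha> else if k = ?N then complex_of_real \<beta> else 0)" for k
  have psi: "psi_proj n \<alpha> \<beta> = mat (2^n) (2^n) (\<lambda>(i,j). amp i * cnj (amp j))"
    by (simp add: psi_proj_def amp_def)
  have psic: "psi_proj n \<alpha> \<beta> \<in> carrier_mat (2^n) (2^n)" by (simp add: psi_proj_def)
  fix a b assume "a < dim_row (ghz_diag n (rho_diag n \<alpha> \<beta> \<gamma>) (cc n \<alpha> \<beta> \<gamma>))"
    "b < dim_col (ghz_diag n (rho_diag n \<alpha> \<beta> \<gamma>) (cc n \<alpha> \<beta> \<gamma>))"
  then have a: "a < 2^n" and b: "b < 2^n" by (auto simp: ghz_diag_def)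
  define F where "F = replicate n False"
  define v where "v bs x = of_bool (x = 0 \<and> bs = F) * \<alpha> + of_bool (bs = flip_pattern n x) * flip_amp \<gamma> n x * \<beta>"
    for bs x
  have F: "F = flip_pattern n x \<longleftrightarrow> x = ?N" if "x < 2^n" for x
    using flip_pattern_eq_iff[OF that N(2)] unfolding F_def flip_pattern_top by metis
  have "(kron_list (map (ad_kraus \<gamma>) bs) * psi_proj n \<alpha> \<beta> * adj (kron_list (map (ad_kraus \<gamma>) bs))) $$ (a,b)
      = complex_of_real (v bs a * v bs b)" if bs: "length bs = n" for bs
  proof -
    let ?K = "kron_list (map (ad_kraus \<gamma>) bs)"
    have "set (map (ad_kraus \<gamma>) bs) \<subseteq> carrier_mat 2 2" using ad_kraus_carrier by auto
    from kron_list_carrier[OF this] have Kc: "?K \<in> carrier_mat (2^n) (2^n)" using bs by simp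
    have v: "(\<Sum>k<2^n. ?K $$ (x,k) * amp k) = complex_of_real (v bs x)" if x: "x < 2^n" for x
    proof -
      have "(\<Sum>k<2^n. ?K $$ (x,k) * amp k) = ?K $$ (x,0) * amp 0 + ?K $$ (x,?N) * amp ?N"
        by (rule sum_two[OF _ N]) (simp add: amp_def)
      then show ?thesis
        using N unfolding ad_kraus_column_0[OF bs x] ad_kraus_column_top[OF bs x]
        by (simp add: amp_def v_def F_def)
    qed
    have "(?K * psi_proj n \<alpha> \<beta> * adj ?K) $$ (a,b)
        = (\<Sum>k<2^n. \<Sum>l<2^n. (?K $$ (a,l) * amp l) * cnj (?K $$ (b,k) * amp k))"
      unfolding conj_index[OF Kc psic a b] by (intro sum.cong refl) (simp add: psi)
    also have "\<dots> = (\<Sum>l<2^n. ?K $$ (a,l) * amp l) * cnj (\<Sum>k<2^n. ?K $$ (b,k) * amp k)"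
      by (subst sum.swap) (simp only: sum_product cnj_sum)
    finally show ?thesis by (simp add: v a b)
  qed
  then have "rho_n n \<alpha> \<beta> \<gamma> $$ (a,b) = (\<Sum>bs | length bs = n. complex_of_real (v bs a * v bs b))"
    using a b unfolding rho_n_def ad_channel_n_def by simp
  also have "\<dots> = complex_of_real (\<Sum>bs | length bs = n. v bs a * v bs b)" by simp
  also have "(\<Sum>bs | length bs = n. v bs a * v bs b)
      = (\<Sum>bs | length bs = n. (if bs = F then of_bool (a = 0 \<and> b = 0) * \<alpha>\<^sup>2
            + \<alpha> * \<beta> * (of_bool (a = 0 \<and> b = ?N) * flip_amp \<gamma> n b + of_bool (b = 0 \<and> a = ?N) * flip_amp \<gamma> n a) else 0)
          + (if bs = flip_pattern n a then of_bool (a = b) * \<beta>\<^sup>2 * (flip_amp \<gamma> n a)\<^sup>2 else 0))"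
  proof (intro sum.cong refl)
    fix bs
    have "v bs a * v bs b = of_bool (a = 0 \<and> b = 0 \<and> bs = F) * \<alpha>\<^sup>2
        + \<alpha> * \<beta> * (of_bool (a = 0 \<and> bs = F \<and> bs = flip_pattern n b) * flip_amp \<gamma> n b
          + of_bool (b = 0 \<and> bs = F \<and> bs = flip_pattern n a) * flip_amp \<gamma> n a)
        + of_bool (bs = flip_pattern n a \<and> bs = flip_pattern n b) * \<beta>\<^sup>2 * flip_amp \<gamma> n a * flip_amp \<gamma> n b"
      unfolding v_def by (rule of_bool_expand)
    moreover have "bs = F \<and> bs = flip_pattern n x \<longleftrightarrow> bs = F \<and> x = ?N" if "x < 2^n" for x
      using F[OF that] by auto
    moreover have "bs = flip_pattern n a \<and> bs = flip_pattern n b \<longleftrightarrow> bs = flip_pattern n a \<and> a = b"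
      using flip_pattern_eq_iff[OF a b] by auto
    ultimately show "v bs a * v bs b
        = (if bs = F then of_bool (a = 0 \<and> b = 0) * \<alpha>\<^sup>2
            + \<alpha> * \<beta> * (of_bool (a = 0 \<and> b = ?N) * flip_amp \<gamma> n b + of_bool (b = 0 \<and> a = ?N) * flip_amp \<gamma> n a) else 0)
          + (if bs = flip_pattern n a then of_bool (a = b) * \<beta>\<^sup>2 * (flip_amp \<gamma> n a)\<^sup>2 else 0)"
      using a b by (simp add: power2_eq_square del: One_nat_def)
  qed
  also have "\<dots> = of_bool (a = 0 \<and> b = 0) * \<alpha>\<^sup>2
      + \<alpha> * \<beta> * (of_bool (a = 0 \<and> b = ?N) * flip_amp \<gamma> n b + of_bool (b = 0 \<and> a = ?N) * flip_amp \<gamma> n a)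
      + of_bool (a = b) * \<beta>\<^sup>2 * (flip_amp \<gamma> n a)\<^sup>2"
  proof -
    have "finite {bs :: bool list. length bs = n}"
      using finite_lists_length_eq[of "UNIV :: bool set" n] by simp
    moreover have "length F = n" by (simp add: F_def)
    ultimately show ?thesis by (simp add: sum.distrib)
  qed
  also have "\<dots> = (if a = b then rho_diag n \<alpha> \<beta> \<gamma> a
      else if a \<in> {0, ?N} \<and> b \<in> {0, ?N} then cc n \<alpha> \<beta> \<gamma> else 0)"
    using N(1) by (auto simp: rho_diag_def cc_def flip_amp_top simp del: One_nat_def)
  finally show "rho_n n \<alpha> \<beta> \<gamma> $$ (a,b) = ghz_diag n (rho_diag n \<alpha> \<beta> \<gamma>) (cc n \<alpha> \<beta> \<gamma>) $$ (a,b)"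
    using a b by (simp add: ghz_diag_def)
qed (simp_all add: ghz_diag_def rho_n_def ad_channel_n_def)

lemma rho_diag_0: "0 \<le> \<gamma> \<Longrightarrow> rho_diag n \<alpha> \<beta> \<gamma> 0 = P0 n \<alpha> \<beta> \<gamma>"
  by (simp add: rho_diag_def P0_def flip_amp_def power_mult[symmetric] mult.commute[of n] power_mult)

lemma rho_diag_top: "n \<ge> 1 \<Longrightarrow> \<gamma> \<le> 1 \<Longrightarrow> rho_diag n \<alpha> \<beta> \<gamma> (2^n - 1) = Pn n \<alpha> \<beta> \<gamma>"
  using top_index(1)[of n] unfolding rho_diag_def Pn_def flip_amp_top by simp

lemma rho_diag_sum:
  assumes "0 \<le> \<gamma>" "\<gamma> \<le> 1" "\<alpha>\<^sup>2 + \<beta>\<^sup>2 = 1"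
  shows "(\<Sum>a<2^n. rho_diag n \<alpha> \<beta> \<gamma> a) = 1"
  using assms(3) by (simp add: rho_diag_def sum.distrib sum_distrib_left[symmetric] sum_flip_amp_square[OF assms(1,2)])

subsection \<open>The postselection procedure\<close>

lemma on_qubit_diag:
  assumes A: "A \<in> carrier_mat 2 2" "A $$ (0,1) = 0" "A $$ (1,0) = 0" and k: "k < n"
  shows "on_qubit n k A = mat (2^n) (2^n) (\<lambda>(a,b). if a = b then A $$ (qbit n a k, qbit n a k) else 0)"
proof (rule eq_matI)
  let ?l = "map (\<lambda>j. if j = k then A else pI) [0..<n]"
  have l: "set ?l \<subseteq> carrier_mat 2 2" "length ?l = n" using A(1) by (auto simp: pI_def)
  have car: "on_qubit n k A \<in> carrier_mat (2^n) (2^n)"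
    using kron_list_carrier[OF l(1)] l(2) unfolding on_qubit_def by simp
  then show "dim_row (on_qubit n k A) = dim_row (mat (2^n) (2^n) (\<lambda>(a,b). if a = b then A $$ (qbit n a k, qbit n a k) else 0))"
    "dim_col (on_qubit n k A) = dim_col (mat (2^n) (2^n) (\<lambda>(a,b). if a = b then A $$ (qbit n a k, qbit n a k) else 0))"
    by simp_all
  fix a b assume "a < dim_row (mat (2^n) (2^n) (\<lambda>(a,b). if a = b then A $$ (qbit n a k, qbit n a k) else 0))"
    "b < dim_col (mat (2^n) (2^n) (\<lambda>(a,b). if a = b then A $$ (qbit n a k, qbit n a k) else 0))"
  then have a: "a < 2^n" and b: "b < 2^n" by auto
  have "on_qubit n k A $$ (a,b) = (\<Prod>j<n. ?l ! j $$ (qbit n a j, qbit n b j))"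
    unfolding on_qubit_def by (rule kron_list_index[OF l(2,1) a b])
  also have "\<dots> = (\<Prod>j<n. of_bool (qbit n a j = qbit n b j) * (if j = k then A $$ (qbit n a k, qbit n a k) else 1))"
  proof (rule prod.cong[OF refl])
    fix j assume "j \<in> {..<n}"
    then show "?l ! j $$ (qbit n a j, qbit n b j)
        = of_bool (qbit n a j = qbit n b j) * (if j = k then A $$ (qbit n a k, qbit n a k) else 1)"
      using qbit_cases[of n a j] qbit_cases[of n b j] A(2,3) by (auto simp: pI_def)
  qed
  also have "\<dots> = of_bool (\<forall>j<n. qbit n a j = qbit n b j) * A $$ (qbit n a k, qbit n a k)"
    unfolding prod.distrib using k by (subst prod_of_bool) auto
  finally show "on_qubit n k A $$ (a,b) = mat (2^n) (2^n) (\<lambda>(a,b). if a = b then A $$ (qbit n a k, qbit n a k) else 0) $$ (a,b)"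
    using a b unfolding qbit_ext[OF a b] by simp
qed

lemma diag_mat_mult:
  fixes f g :: "nat \<Rightarrow> 'a::semiring_0"
  shows "mat d d (\<lambda>(a,b). if a = b then f a else 0) * mat d d (\<lambda>(a,b). if a = b then g a else 0)
    = mat d d (\<lambda>(a,b). if a = b then f a * g a else 0)"
proof (rule eq_matI)
  fix a b assume "a < dim_row (mat d d (\<lambda>(a,b). if a = b then f a * g a else 0))"
    "b < dim_col (mat d d (\<lambda>(a,b). if a = b then f a * g a else 0))"
  then have a: "a < d" and b: "b < d" by auto
  have "(\<Sum>k = 0..<d. (if a = k then f a else 0) * (if k = b then g k else 0))
      = (\<Sum>k = 0..<d. if k = a then (if a = b then f a * g a else 0) else 0)"
    by (intro sum.cong) auto
  then show "(mat d d (\<lambda>(a,b). if a = b then f a else 0) * mat d d (\<lambda>(a,b). if a = b then g a else 0)) $$ (a,b)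
      = mat d d (\<lambda>(a,b). if a = b then f a * g a else 0) $$ (a,b)"
    using a b by (simp add: scalar_prod_def)
qed auto

lemma mat_prod_list_diag:
  assumes "\<And>i. i \<in> set xs \<Longrightarrow> F i = mat d d (\<lambda>(a,b). if a = b then f i a else 0)"
  shows "mat_prod_list d (map F xs) = mat d d (\<lambda>(a,b). if a = b then prod_list (map (\<lambda>i. f i a) xs) else 0)"
  using assms
proof (induction xs)
  case Nil
  show ?case by (rule eq_matI) auto
next
  case (Cons x xs)
  have F: "F x = mat d d (\<lambda>(a,b). if a = b then f x a else 0)" by (rule Cons.prems) simp
  have IH: "mat_prod_list d (map F xs) = mat d d (\<lambda>(a,b). if a = b then prod_list (map (\<lambda>i. f i a) xs) else 0)"
    by (rule Cons.IH) (simp add: Cons.prems)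
  show ?case unfolding list.map mat_prod_list.simps prod_list.Cons IH F by (rule diag_mat_mult)
qed

lemma prod_list_of_bool: "prod_list (map (\<lambda>i. of_bool (Q i)) xs) = (of_bool (\<forall>i\<in>set xs. Q i) :: 'a::semiring_1)"
  by (induction xs) auto

text \<open>Each factor (I + Z Z)/2 is diagonal and selects equal neighbouring bits. If all
  neighbours agree, the bit string is constant.\<close>

lemma postsel_proj_eq:
  assumes n: "n \<ge> 1"
  shows "postsel_proj n = mat (2^n) (2^n) (\<lambda>(a,b). if a = b then of_bool (a \<in> {0, 2^n - 1}) else 0)"
proof -
  have Z: "pZ \<in> carrier_mat 2 2" "pZ $$ (0,1) = 0" "pZ $$ (1,0) = 0" by (simp_all add: pZ_def)
  have "postsel_proj n = mat (2^n) (2^n) (\<lambda>(a,b). if a = b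
      then prod_list (map (\<lambda>i. of_bool (qbit n a i = qbit n a (Suc i))) [0..<n-1]) else 0)"
    unfolding postsel_proj_def
  proof (rule mat_prod_list_diag)
    fix i assume "i \<in> set [0..<n - 1]"
    then have i: "i < n" "Suc i < n" by auto
    show "(1/2::complex) \<cdot>\<^sub>m (1\<^sub>m (2^n) + on_qubit n i pZ * on_qubit n (Suc i) pZ)
        = mat (2^n) (2^n) (\<lambda>(a,b). if a = b then of_bool (qbit n a i = qbit n a (Suc i)) else 0)"
      unfolding on_qubit_diag[OF Z i(1)] on_qubit_diag[OF Z i(2)] diag_mat_mult
    proof (rule eq_matI)
      fix a b :: nat
      show "((1/2::complex) \<cdot>\<^sub>m (1\<^sub>m (2^n) + mat (2^n) (2^n) (\<lambda>(a,b). if a = b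
          then pZ $$ (qbit n a i, qbit n a i) * pZ $$ (qbit n a (Suc i), qbit n a (Suc i)) else 0))) $$ (a,b)
        = mat (2^n) (2^n) (\<lambda>(a,b). if a = b then of_bool (qbit n a i = qbit n a (Suc i)) else 0) $$ (a,b)"
        if "a < dim_row (mat (2^n) (2^n) (\<lambda>(a,b). if a = b then of_bool (qbit n a i = qbit n a (Suc i)) else (0::complex)))"
          "b < dim_col (mat (2^n) (2^n) (\<lambda>(a,b). if a = b then of_bool (qbit n a i = qbit n a (Suc i)) else (0::complex)))"
        using that qbit_cases[of n a i] qbit_cases[of n a "Suc i"] by (auto simp: pZ_def)
    qed auto
  qed
  also have "\<dots> = mat (2^n) (2^n) (\<lambda>(a,b). if a = b then of_bool (a \<in> {0, 2^n - 1}) else 0)"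
  proof (rule eq_matI)
    fix a b assume "a < dim_row (mat (2^n) (2^n) (\<lambda>(a,b). if a = b then of_bool (a \<in> {0, 2^n - 1}) else (0::complex)))"
      "b < dim_col (mat (2^n) (2^n) (\<lambda>(a,b). if a = b then of_bool (a \<in> {0, 2^n - 1}) else (0::complex)))"
    then have a: "a < 2^n" and b: "b < 2^n" by auto
    have "(\<forall>i\<in>set [0..<n-1]. qbit n a i = qbit n a (Suc i)) \<longleftrightarrow> a \<in> {0, 2^n - 1}"
    proof
      assume *: "\<forall>i\<in>set [0..<n-1]. qbit n a i = qbit n a (Suc i)"
      have const: "i < n \<Longrightarrow> qbit n a i = qbit n a 0" for i
        by (induction i) (use * in auto)
      show "a \<in> {0, 2^n - 1}"
      proof (cases "qbit n a 0 = 0")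
        case True
        then have "a = 0" using const qbit_ext[OF a, of 0] by simp
        then show ?thesis by simp
      next
        case False
        then have "qbit n a 0 = 1" using qbit_cases[of n a 0] by simp
        then have "\<forall>k<n. qbit n a k = qbit n (2^n - 1) k" using const by simp
        then have "a = 2^n - 1" using qbit_ext[OF a top_index(2)] by blast
        then show ?thesis by blast
      qed
    qed auto
    then have "prod_list (map (\<lambda>i. of_bool (qbit n a i = qbit n a (Suc i))) [0..<n-1])
        = (of_bool (a \<in> {0, 2^n - 1}) :: complex)"
      by (simp only: prod_list_of_bool)
    then show "mat (2^n) (2^n) (\<lambda>(a,b). if a = b
        then prod_list (map (\<lambda>i. of_bool (qbit n a i = qbit n a (Suc i))) [0..<n-1]) else (0::complex)) $$ (a,b)
      = mat (2^n) (2^n) (\<lambda>(a,b). if a = b then of_bool (a \<in> {0, 2^n - 1}) else 0) $$ (a,b)"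
      using a b by auto
  qed auto
  finally show ?thesis .
qed

lemma postsel_conj_index:
  assumes n: "n \<ge> 1" and M: "M \<in> carrier_mat (2^n) (2^n)" and a: "a < 2^n" and b: "b < 2^n"
  shows "(postsel_proj n * M * postsel_proj n) $$ (a,b)
    = of_bool (a \<in> {0, 2^n - 1} \<and> b \<in> {0, 2^n - 1}) * M $$ (a,b)"
proof -
  let ?P = "postsel_proj n" and ?e = "\<lambda>x. of_bool (x \<in> {0, 2^n - 1}) :: complex"
  have Pc: "?P \<in> carrier_mat (2^n) (2^n)" by (simp add: postsel_proj_eq[OF n])
  \<comment> \<open>The projector is real and diagonal, so \<open>conj_index\<close> applies to a
    product with \<open>?P\<close> on both sides.\<close>
  have "adj ?P = ?P" by (rule eq_matI) (auto simp: postsel_proj_eq[OF n] adj_def)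
  then have "(?P * M * ?P) $$ (a,b) = (\<Sum>k<2^n. \<Sum>l<2^n. ?P $$ (a,l) * M $$ (l,k) * cnj (?P $$ (b,k)))"
    using conj_index[OF Pc M a b] by simp
  also have "\<dots> = (\<Sum>k<2^n. if k = b then (\<Sum>l<2^n. if l = a then ?e a * M $$ (a,b) * ?e b else 0) else 0)"
  proof (intro sum.cong refl)
    fix k assume "k \<in> {..<2^n :: nat}"
    then have k: "?P $$ (b,k) = (if b = k then ?e b else 0)" using b by (simp add: postsel_proj_eq[OF n])
    have l: "?P $$ (a,l) = (if a = l then ?e a else 0)" if "l < 2^n" for l
      using that a by (simp add: postsel_proj_eq[OF n])
    show "(\<Sum>l<2^n. ?P $$ (a,l) * M $$ (l,k) * cnj (?P $$ (b,k)))
        = (if k = b then (\<Sum>l<2^n. if l = a then ?e a * M $$ (a,b) * ?e b else 0) else 0)"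
    proof (cases "k = b")
      case True
      then show ?thesis unfolding k by (simp only: simp_thms if_True) (intro sum.cong refl, simp add: l)
    qed (simp add: k)
  qed
  finally show ?thesis using a b by simp
qed

section \<open>The CNOT cascade on the two basis states that survive postselection\<close>

definition prefix_ones :: "nat \<Rightarrow> nat \<Rightarrow> nat" where
  "prefix_ones n t = push_bit (n - t) (mask t)"

lemma prefix_ones_less: "t \<le> n \<Longrightarrow> prefix_ones n t < 2^n"
proof -
  assume t: "t \<le> n"
  have "prefix_ones n t < 2^t * 2^(n - t)"
    by (simp add: prefix_ones_def push_bit_eq_mult mask_eq_exp_minus_1)
  also have "\<dots> = 2^n" using t by (simp flip: power_add)
  finally show ?thesis .
qed

lemma qbit_prefix_ones: "k < n \<Longrightarrow> t \<le> n \<Longrightarrow> qbit n (prefix_ones n t) k = of_bool (k < t)"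
  by (auto simp: qbit_def prefix_ones_def bit_push_bit_iff bit_mask_iff)

lemma prefix_ones_self: "prefix_ones n n = 2^n - 1"
  by (simp add: prefix_ones_def mask_eq_exp_minus_1)

lemma prefix_ones_1: "prefix_ones n 1 = 2^(n - 1)"
  by (simp add: prefix_ones_def push_bit_eq_mult mask_eq_exp_minus_1)

lemma cnot_carrier: "0 < n \<Longrightarrow> cnot n 0 t \<in> carrier_mat (2^n) (2^n)"
proof -
  let ?l = "map (\<lambda>j. if j = 0 then proj1 else if j = t then pX else pI) [0..<n]"
  have "set ?l \<subseteq> carrier_mat 2 2" by (auto simp: proj1_def pX_def pI_def)
  from kron_list_carrier[OF this] show ?thesis
    unfolding cnot_def by (intro add_carrier_mat) simp
qed

text \<open>The two summands belong to the two values of the control bit of the column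
  \<open>y\<close>; \<open>1 - qbit n y k\<close> is the negated bit.\<close>

lemma cnot_index:
  assumes t: "1 \<le> t" "t < n" and x: "x < 2^n" and y: "y < 2^n"
  shows "cnot n 0 t $$ (x,y) = of_bool (qbit n y 0 = 0 \<and> x = y)
    + of_bool (qbit n y 0 = 1 \<and> (\<forall>k<n. qbit n x k = (if k = t then 1 - qbit n y k else qbit n y k)))"
proof -
  let ?l = "map (\<lambda>j. if j = 0 then proj1 else if j = t then pX else pI) [0..<n]"
  have P0: "proj0 \<in> carrier_mat 2 2" "proj0 $$ (0,1) = 0" "proj0 $$ (1,0) = 0"
    by (simp_all add: proj0_def)
  have l: "set ?l \<subseteq> carrier_mat 2 2" "length ?l = n" by (auto simp: proj1_def pX_def pI_def)
  have n: "0 < n" using t by simp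
  have "kron_list ?l $$ (x,y) = (\<Prod>j<n. ?l ! j $$ (qbit n x j, qbit n y j))"
    by (rule kron_list_index[OF l(2,1) x y])
  also have "\<dots> = (\<Prod>j<n. of_bool ((j = 0 \<longrightarrow> qbit n y 0 = 1)
      \<and> qbit n x j = (if j = t then 1 - qbit n y j else qbit n y j)))"
  proof (rule prod.cong[OF refl])
    fix j assume "j \<in> {..<n}"
    then show "?l ! j $$ (qbit n x j, qbit n y j) = of_bool ((j = 0 \<longrightarrow> qbit n y 0 = 1)
        \<and> qbit n x j = (if j = t then 1 - qbit n y j else qbit n y j))"
      using qbit_cases[of n x j] qbit_cases[of n y j] t by (auto simp: proj1_def pX_def pI_def)
  qed
  also have "\<dots> = of_bool (qbit n y 0 = 1 \<and> (\<forall>k<n. qbit n x k = (if k = t then 1 - qbit n y k else qbit n y k)))"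
    using n by (subst prod_of_bool) auto
  finally have 1: "kron_list ?l $$ (x,y) = of_bool (qbit n y 0 = 1
      \<and> (\<forall>k<n. qbit n x k = (if k = t then 1 - qbit n y k else qbit n y k)))" .
  have "cnot n 0 t $$ (x,y) = on_qubit n 0 proj0 $$ (x,y) + kron_list ?l $$ (x,y)"
    using kron_list_carrier[OF l(1)] x y unfolding cnot_def by simp
  also have "on_qubit n 0 proj0 $$ (x,y) = of_bool (qbit n y 0 = 0 \<and> x = y)"
    unfolding on_qubit_diag[OF P0 n] using x y qbit_cases[of n y 0] by (auto simp: proj0_def)
  finally show ?thesis unfolding 1 .
qed

lemma cnot_column_0: "1 \<le> t \<Longrightarrow> t < n \<Longrightarrow> x < 2^n \<Longrightarrow> cnot n 0 t $$ (x,0) = of_bool (x = 0)"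
  by (simp add: cnot_index)

text \<open>The control bit is set and qubit \<open>t\<close> is the last one set, so the gate
  clears it.\<close>

lemma cnot_column_prefix:
  assumes t: "1 \<le> t" "t < n" and x: "x < 2^n"
  shows "cnot n 0 t $$ (x, prefix_ones n (Suc t)) = of_bool (x = prefix_ones n t)"
proof -
  have "qbit n (prefix_ones n (Suc t)) 0 = 1" using t by (simp add: qbit_prefix_ones)
  then have "cnot n 0 t $$ (x, prefix_ones n (Suc t)) = of_bool (\<forall>k<n. qbit n x k
      = (if k = t then 1 - qbit n (prefix_ones n (Suc t)) k else qbit n (prefix_ones n (Suc t)) k))"
    using t x by (simp add: cnot_index prefix_ones_less)
  also have "(\<forall>k<n. qbit n x k
      = (if k = t then 1 - qbit n (prefix_ones n (Suc t)) k else qbit n (prefix_ones n (Suc t)) k))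
      \<longleftrightarrow> (\<forall>k<n. qbit n x k = qbit n (prefix_ones n t) k)"
    using t by (intro all_cong1 imp_cong refl) (auto simp: qbit_prefix_ones)
  also have "\<dots> \<longleftrightarrow> x = prefix_ones n t"
    using t by (intro qbit_ext x prefix_ones_less) simp
  finally show ?thesis .
qed

lemma mat_mult_unit_column:
  fixes A B :: "complex mat"
  assumes A: "A \<in> carrier_mat d d" and B: "B \<in> carrier_mat d d" and x: "x < d" and j: "j < d" and y: "y < d"
    and col: "\<And>k. k < d \<Longrightarrow> B $$ (k,j) = of_bool (k = y)"
  shows "(A * B) $$ (x,j) = A $$ (x,y)"
proof -
  have "(A * B) $$ (x,j) = (\<Sum>k<d. A $$ (x,k) * B $$ (k,j))"
    by (rule mult_mat_index[OF A B x j])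
  also have "\<dots> = (\<Sum>k<d. if k = y then A $$ (x,y) else 0)"
    by (intro sum.cong refl) (simp add: col)
  finally show ?thesis using y by simp
qed

text \<open>The postselected state lives on |0...0> and |1...1>, so these two columns determine the
  output. The rightmost gate acts first: the gates with targets \<open>t\<close> and above clear the
  last qubits of |1...1> and leave a prefix of \<open>t\<close> ones. Descending from
  \<open>t = n\<close> to \<open>t = 1\<close> ends at |10...0>, the index
  \<open>2^(n - 1)\<close>.\<close>

lemma cnot_cascade_columns:
  assumes n: "n \<ge> 1"
  shows "cnot_cascade n \<in> carrier_mat (2^n) (2^n)"
    and "x < 2^n \<Longrightarrow> cnot_cascade n $$ (x,0) = of_bool (x = 0)"
    and "x < 2^n \<Longrightarrow> cnot_cascade n $$ (x,2^n - 1) = of_bool (x = 2^(n - 1))"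
proof -
  let ?W = "\<lambda>t. mat_prod_list (2^n) (map (cnot n 0) [t..<n])"
  have "t \<le> n \<Longrightarrow> 1 \<le> t \<Longrightarrow> ?W t \<in> carrier_mat (2^n) (2^n) \<and>
      (\<forall>x<2^n. ?W t $$ (x,0) = of_bool (x = 0)) \<and>
      (\<forall>x<2^n. ?W t $$ (x,2^n - 1) = of_bool (x = prefix_ones n t))" for t
  proof (induction rule: inc_induct)
    case base
    show ?case using top_index(2)[of n] by (auto simp: prefix_ones_self)
  next
    case (step t)
    note IH = step.IH[OF le_SucI[OF step.prems]]
    have W: "?W t = cnot n 0 t * ?W (Suc t)" using step.hyps by (simp add: upt_conv_Cons)
    have C: "cnot n 0 t \<in> carrier_mat (2^n) (2^n)" using cnot_carrier n by simp
    show ?case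
      unfolding W
    proof (intro conjI allI impI)
      show "cnot n 0 t * ?W (Suc t) \<in> carrier_mat (2^n) (2^n)" using C IH by simp
      fix x :: nat assume x: "x < 2^n"
      show "(cnot n 0 t * ?W (Suc t)) $$ (x,0) = of_bool (x = 0)"
        by (subst mat_mult_unit_column[OF C _ x, where y = 0])
          (use IH cnot_column_0[OF step.prems step.hyps(2) x] in auto)
      show "(cnot n 0 t * ?W (Suc t)) $$ (x,2^n - 1) = of_bool (x = prefix_ones n t)"
        by (subst mat_mult_unit_column[OF C _ x, where y = "prefix_ones n (Suc t)"])
          (use IH cnot_column_prefix[OF step.prems step.hyps(2) x] prefix_ones_less[of "Suc t" n] step.hyps in auto)
    qed
  qed
  from this[of 1] n have "cnot_cascade n \<in> carrier_mat (2^n) (2^n) \<and>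
      (\<forall>x<2^n. cnot_cascade n $$ (x,0) = of_bool (x = 0)) \<and>
      (\<forall>x<2^n. cnot_cascade n $$ (x,2^n - 1) = of_bool (x = 2^(n - 1)))"
    unfolding cnot_cascade_def prefix_ones_1 by simp
  then show "cnot_cascade n \<in> carrier_mat (2^n) (2^n)"
    "x < 2^n \<Longrightarrow> cnot_cascade n $$ (x,0) = of_bool (x = 0)"
    "x < 2^n \<Longrightarrow> cnot_cascade n $$ (x,2^n - 1) = of_bool (x = 2^(n - 1))" by blast+
qed

lemma postsel_prob_ghz_diag:
  assumes n: "n \<ge> 1"
  shows "postsel_prob n (ghz_diag n d c) = complex_of_real (d 0 + d (2^n - 1))"
proof -
  let ?N = "2^n - 1 :: nat"
  note N = top_index(1)[OF n] top_index(2)[of n]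
  have rc: "ghz_diag n d c \<in> carrier_mat (2^n) (2^n)" by (simp add: ghz_diag_def)
  have "dim_row (postsel_proj n * ghz_diag n d c * postsel_proj n) = 2^n"
    by (simp add: postsel_proj_eq[OF n])
  then have "postsel_prob n (ghz_diag n d c)
      = (\<Sum>a<2^n. of_bool (a \<in> {0, ?N} \<and> a \<in> {0, ?N}) * ghz_diag n d c $$ (a,a))"
    unfolding postsel_prob_def mtrace_def
    by (intro sum.cong) (simp_all add: postsel_conj_index[OF n rc] del: One_nat_def)
  also have "\<dots> = of_bool (0 \<in> {0, ?N} \<and> 0 \<in> {0, ?N}) * ghz_diag n d c $$ (0,0)
      + of_bool (?N \<in> {0, ?N} \<and> ?N \<in> {0, ?N}) * ghz_diag n d c $$ (?N,?N)"
    by (rule sum_two[OF _ N]) auto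
  also have "\<dots> = complex_of_real (d 0 + d ?N)" using N by (simp add: ghz_diag_def)
  finally show ?thesis .
qed

text \<open>The cascade maps the two surviving basis states to |0>|0...0> and |1>|0...0>. The other
  qubits end in a fixed state, so the partial trace has only its \<open>k = 0\<close> term and keeps
  the coherence.\<close>

lemma procedure_out_ghz_diag:
  assumes n: "n \<ge> 1"
  shows "procedure_out n (ghz_diag n d c) = (1 / complex_of_real (d 0 + d (2^n - 1))) \<cdot>\<^sub>m
    mat2 (complex_of_real (d 0)) (complex_of_real c) (complex_of_real c) (complex_of_real (d (2^n - 1)))"
proof -
  let ?N = "2^n - 1 :: nat" and ?H = "2^(n-1) :: nat" and ?W = "cnot_cascade n"
  define M where "M = postsel_proj n * ghz_diag n d c * postsel_proj n"
  note N = top_index(1)[OF n] top_index(2)[of n]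
  note W = cnot_cascade_columns[OF n]
  have rc: "ghz_diag n d c \<in> carrier_mat (2^n) (2^n)" by (simp add: ghz_diag_def)
  have Pc: "postsel_proj n \<in> carrier_mat (2^n) (2^n)" by (simp add: postsel_proj_eq[OF n])
  have Mc: "M \<in> carrier_mat (2^n) (2^n)"
    unfolding M_def by (rule mult_carrier_mat[OF mult_carrier_mat[OF Pc rc] Pc])
  have Mi: "M $$ (a,b) = of_bool (a \<in> {0, ?N} \<and> b \<in> {0, ?N}) * ghz_diag n d c $$ (a,b)"
    if "a < 2^n" "b < 2^n" for a b
    unfolding M_def by (rule postsel_conj_index[OF n rc that])
  have Mv: "M $$ (0,0) = complex_of_real (d 0)" "M $$ (0,?N) = complex_of_real c"
    "M $$ (?N,0) = complex_of_real c" "M $$ (?N,?N) = complex_of_real (d ?N)"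
    using N by (simp_all add: Mi ghz_diag_def del: One_nat_def)
  have WMW: "(?W * M * adj ?W) $$ (x,y)
      = of_bool (x = 0 \<and> y = 0) * complex_of_real (d 0) + of_bool (x = ?H \<and> y = 0) * complex_of_real c
        + (of_bool (x = 0 \<and> y = ?H) * complex_of_real c + of_bool (x = ?H \<and> y = ?H) * complex_of_real (d ?N))"
    if x: "x < 2^n" and y: "y < 2^n" for x y
  proof -
    let ?f = "\<lambda>k l. ?W $$ (x,l) * M $$ (l,k) * cnj (?W $$ (y,k))"
    have "(?W * M * adj ?W) $$ (x,y) = (\<Sum>k<2^n. \<Sum>l<2^n. ?f k l)"
      by (rule conj_index[OF W(1) Mc x y])
    also have "\<dots> = (\<Sum>l<2^n. ?f 0 l) + (\<Sum>l<2^n. ?f ?N l)"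
      by (rule sum_two[OF _ N]) (auto intro!: sum.neutral simp: Mi)
    also have "(\<Sum>l<2^n. ?f 0 l) = ?f 0 0 + ?f 0 ?N"
      by (rule sum_two[OF _ N]) (auto simp: Mi)
    also have "(\<Sum>l<2^n. ?f ?N l) = ?f ?N 0 + ?f ?N ?N"
      by (rule sum_two[OF _ N]) (use N in \<open>auto simp: Mi\<close>)
    finally show ?thesis unfolding Mv W(2)[OF x] W(2)[OF y] W(3)[OF x] W(3)[OF y] by simp
  qed
  have HH: "2 * ?H = 2^n" using n by (cases n) auto
  have "ptrace_rest n (?W * M * adj ?W) = mat2 (complex_of_real (d 0)) (complex_of_real c)
      (complex_of_real c) (complex_of_real (d ?N))" (is "_ = ?R")
  proof (rule eq_matI)
    fix a b assume "a < dim_row ?R" "b < dim_col ?R"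
    then have ab: "a < 2" "b < 2" by (auto simp: mat2_def)
    \<comment> \<open>In the index \<open>e * ?H + k\<close> the first qubit is \<open>e\<close> and
      the discarded qubits hold \<open>k\<close>.\<close>
    have lt: "e * ?H + k < 2^n" if "e < 2" "k < ?H" for e k
      using that HH by (cases e) auto
    have z: "e * ?H + k = 0 \<longleftrightarrow> e = 0 \<and> k = 0" "e * ?H + k = ?H \<longleftrightarrow> e = 1 \<and> k = 0"
      if "e < 2" "k < ?H" for e k
      using that by (cases e; auto)+
    have "ptrace_rest n (?W * M * adj ?W) $$ (a,b)
        = (\<Sum>k<?H. (?W * M * adj ?W) $$ (a * ?H + k, b * ?H + k))"
      using ab by (simp add: ptrace_rest_def)
    also have "\<dots> = (\<Sum>k<?H. if k = 0 then ?R $$ (a,b) else 0)"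
    proof (intro sum.cong refl)
      fix k assume "k \<in> {..<?H}"
      then have k: "k < ?H" by simp
      have "a = 0 \<or> a = 1" "b = 0 \<or> b = 1" using ab by auto
      then show "(?W * M * adj ?W) $$ (a * ?H + k, b * ?H + k) = (if k = 0 then ?R $$ (a,b) else 0)"
        unfolding WMW[OF lt[OF ab(1) k] lt[OF ab(2) k]] z[OF ab(1) k] z[OF ab(2) k] by auto
    qed
    finally show "ptrace_rest n (?W * M * adj ?W) $$ (a,b) = ?R $$ (a,b)" by simp
  qed (simp_all add: ptrace_rest_def mat2_def)
  then show ?thesis
    unfolding procedure_out_def postsel_prob_ghz_diag[OF n] M_def by simp
qed

section \<open>Bloch coordinates, the octahedron and the comparison of both sides\<close>

lemma mem_octahedron_iff:
  assumes s: "p0 + p1 \<noteq> 0"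
  shows "(1 / complex_of_real (p0 + p1)) \<cdot>\<^sub>m mat2 (complex_of_real p0) (complex_of_real c) (complex_of_real c) (complex_of_real p1)
    \<in> octahedron \<longleftrightarrow> \<bar>2 * c / (p0 + p1)\<bar> + \<bar>(p0 - p1) / (p0 + p1)\<bar> \<le> 1" (is "?\<rho> \<in> _ \<longleftrightarrow> _")
proof -
  let ?M = "\<lambda>x y z. (1/2::complex) \<cdot>\<^sub>m (pI + complex_of_real x \<cdot>\<^sub>m pX + complex_of_real y \<cdot>\<^sub>m pY + complex_of_real z \<cdot>\<^sub>m pZ)"
  \<comment> \<open>The matrix entries determine the Bloch vector, so the existential in
    \<open>octahedron\<close> collapses to a single point.\<close>
  have eq: "?\<rho> = ?M x y z \<longleftrightarrow> x = 2 * c / (p0 + p1) \<and> y = 0 \<and> z = (p0 - p1) / (p0 + p1)" for x y z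
  proof -
    have "?\<rho> = ?M x y z \<longleftrightarrow> p0 / (p0 + p1) = (1 + z) / 2 \<and> (c / (p0 + p1) = x / 2 \<and> y = 0) \<and> p1 / (p0 + p1) = (1 - z) / 2"
      by (auto simp: pauli_defs mat2_simps complex_eq_iff)
    also have "p0 / (p0 + p1) = (1 + z) / 2 \<longleftrightarrow> z = (p0 - p1) / (p0 + p1)"
      using s by (auto simp: field_simps)
    also have "p1 / (p0 + p1) = (1 - z) / 2 \<longleftrightarrow> z = (p0 - p1) / (p0 + p1)"
      using s by (auto simp: field_simps)
    finally show ?thesis by auto
  qed
  have "?\<rho> \<in> octahedron \<longleftrightarrow> (\<exists>x y z. ?\<rho> = ?M x y z \<and> \<bar>x\<bar> + \<bar>y\<bar> + \<bar>z\<bar> \<le> 1)"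
    unfolding octahedron_def by blast
  then show ?thesis unfolding eq by auto
qed

lemma bloch_normalized:
  fixes p0 p1 c :: real
  defines "\<rho> \<equiv> (1 / complex_of_real (p0 + p1)) \<cdot>\<^sub>m mat2 (complex_of_real p0) (complex_of_real c) (complex_of_real c) (complex_of_real p1)"
  shows "bloch_x \<rho> = 2 * c / (p0 + p1)" "bloch_y \<rho> = 0" "bloch_z \<rho> = (p0 - p1) / (p0 + p1)"
proof -
  have tr: "mtrace (mat2 a b c d) = a + d" for a b c d
    by (simp add: mtrace_def mat2_def numeral_2_eq_2)
  show "bloch_x \<rho> = 2 * c / (p0 + p1)" "bloch_y \<rho> = 0" "bloch_z \<rho> = (p0 - p1) / (p0 + p1)"
    unfolding \<rho>_def bloch_x_def bloch_y_def bloch_z_def pauli_defs mat2_smult mat2_mult tr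
    by (simp_all add: diff_divide_distrib)
qed

text \<open>After multiplication by \<open>s\<close> this is the identity p0 + p1 - |p0 - p1| = 2
  min(p0, p1).\<close>

lemma abs_bloch_gt_iff:
  assumes "(s::real) > 0" "c \<ge> 0" "s = p0 + p1"
  shows "\<bar>2 * c / s\<bar> + \<bar>(p0 - p1) / s\<bar> > 1 \<longleftrightarrow> c > min p0 p1"
proof -
  have "\<bar>2 * c / s\<bar> + \<bar>(p0 - p1) / s\<bar> = (2 * c + \<bar>p0 - p1\<bar>) / s"
    using assms by (simp add: abs_mult add_divide_distrib)
  then show ?thesis using assms by (auto simp: less_divide_eq min_def)
qed

text \<open>c is at most the geometric mean of P0 and Pn, since c^2 = \<alpha>^2 Pn and \<alpha>^2
  <= P0. This discharges \<open>c_le\<close> for both states.\<close>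

lemma cc_le_max:
  assumes "0 \<le> \<gamma>" "\<gamma> \<le> 1" "\<alpha> > 0" "\<beta> > 0"
  shows "cc n \<alpha> \<beta> \<gamma> \<le> max (P0 n \<alpha> \<beta> \<gamma>) (Pn n \<alpha> \<beta> \<gamma>)"
proof (rule ccontr)
  let ?c = "cc n \<alpha> \<beta> \<gamma>" and ?p = "P0 n \<alpha> \<beta> \<gamma>" and ?q = "Pn n \<alpha> \<beta> \<gamma>"
  assume "\<not> ?thesis"
  then have "?p < ?c" "?q < ?c" by auto
  moreover have p: "\<alpha>\<^sup>2 \<le> ?p" using assms by (simp add: P0_def)
  moreover have q: "0 \<le> ?q" using assms by (simp add: Pn_def)
  ultimately have "?p * ?q < ?c * ?c"
    by (intro mult_strict_mono') (use order_trans[OF zero_le_power2 p] in auto)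
  also have "?c * ?c = \<alpha>\<^sup>2 * ?q"
    using assms by (simp add: cc_def Pn_def power2_eq_square)
  also have "\<dots> \<le> ?p * ?q" by (rule mult_right_mono[OF p q])
  finally show False by simp
qed

theorem theorem2:
  fixes n :: nat and \<alpha> \<beta> \<gamma> :: real
  assumes "n \<ge> 2" and "\<alpha> > 0" and "\<beta> > 0" and "\<alpha>^2 + \<beta>^2 = 1"
    and "0 \<le> \<gamma>" and "\<gamma> \<le> 1"
  defines "\<rho> \<equiv> rho_n n \<alpha> \<beta> \<gamma>"
    and "p0 \<equiv> P0 n \<alpha> \<beta> \<gamma>" and "pn \<equiv> Pn n \<alpha> \<beta> \<gamma>" and "c \<equiv> cc n \<alpha> \<beta> \<gamma>"
    and "\<rho>' \<equiv> procedure_out n (rho_n n \<alpha> \<beta> \<gamma>)"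
  shows "(postsel_prob n \<rho> = complex_of_real (p0 + pn)) \<and>
    (p0 + pn \<ge> \<alpha>^2) \<and>
    (\<rho>' = (1 / complex_of_real (p0 + pn)) \<cdot>\<^sub>m
               mat2 (complex_of_real p0) (complex_of_real c) (complex_of_real c) (complex_of_real pn)) \<and>
    (bloch_x \<rho>' = 2 * c / (p0 + pn)) \<and>
    (bloch_y \<rho>' = 0) \<and>
    (bloch_z \<rho>' = (p0 - pn) / (p0 + pn)) \<and>
    (\<rho> \<notin> stab_polytope n \<longleftrightarrow> \<rho>' \<notin> octahedron) \<and>
    (\<rho>' \<notin> octahedron \<longleftrightarrow> \<bar>2 * c / (p0 + pn)\<bar> + \<bar>(p0 - pn) / (p0 + pn)\<bar> > 1) \<and>
    (\<bar>2 * c / (p0 + pn)\<bar> + \<bar>(p0 - pn) / (p0 + pn)\<bar> > 1 \<longleftrightarrow> c > min p0 pn) \<and>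
    ((p0 + pn) * (robustness 1 \<rho>' - 1) = robustness n \<rho> - 1)"
proof -
  have n: "n \<ge> 1" using assms(1) by simp
  define s where "s = p0 + pn"
  let ?d = "rho_diag n \<alpha> \<beta> \<gamma>"
  have d: "?d 0 = p0" "?d (2^n - 1) = pn"
    unfolding p0_def pn_def by (rule rho_diag_0 rho_diag_top n assms)+
  have \<rho>: "\<rho> = ghz_diag n ?d c"
    unfolding \<rho>_def c_def by (rule rho_n_eq_ghz_diag[OF n])
  have p0: "p0 \<ge> \<alpha>\<^sup>2" and pn: "pn \<ge> 0" and c0: "c \<ge> 0"
    using assms(2-6) by (simp_all add: p0_def pn_def c_def P0_def Pn_def cc_def)
  have cmax: "c \<le> max p0 pn" unfolding c_def p0_def pn_def by (rule cc_le_max) fact+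
  have s: "s \<ge> \<alpha>\<^sup>2" "s > 0" using p0 pn assms(2) zero_less_power[of \<alpha> 2] unfolding s_def by linarith+
  have p0': "p0 \<ge> 0" using p0 zero_le_power2[of \<alpha>] by linarith
  have \<rho>': "\<rho>' = (1 / complex_of_real s) \<cdot>\<^sub>m
      mat2 (complex_of_real p0) (complex_of_real c) (complex_of_real c) (complex_of_real pn)"
    using procedure_out_ghz_diag[OF n, of ?d c] unfolding \<rho>'_def s_def d \<rho>[unfolded \<rho>_def] .
  interpret A: ghz_diag_state n ?d c
    using cmax unfolding d[symmetric]
    by unfold_locales (use n c0 rho_diag_sum[OF assms(5,6,4)] in \<open>simp_all add: rho_diag_def\<close>)
  let ?e = "\<lambda>a::nat. (if a = 0 then p0 else pn) / s"
  interpret B: ghz_diag_state 1 ?e "c / s"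
  proof unfold_locales
    show "(\<Sum>a<2^1. ?e a) = 1" using s by (simp add: numeral_2_eq_2 s_def add_divide_distrib[symmetric])
    show "c / s \<le> max (?e 0) (?e (2^1 - 1))"
      using cmax s(2) by (auto simp: max_def divide_right_mono divide_le_cancel split: if_splits)
  qed (use p0' pn c0 s in auto)
  have \<rho>'_ghz: "\<rho>' = ghz_diag 1 ?e (c / s)"
    unfolding \<rho>' by (rule eq_matI) (auto simp: ghz_diag_def mat2_def)
  \<comment> \<open>Scaling all three entries by 1/s scales the excess over 1 by 1/s, since s > 0
    can be moved through the minimum and the maximum.\<close>
  have "s * (robustness 1 \<rho>' - 1) = 2 * (s * max 0 (c / s - min (p0 / s) (pn / s)))"
    unfolding \<rho>'_ghz B.robustness_ghz_diag by simp
  also have "\<dots> = 2 * max 0 (c - min p0 pn)"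
  proof -
    have "c / s - min (p0 / s) (pn / s) = (c - min p0 pn) / s"
      using s(2) by (simp add: min_divide_distrib_right diff_divide_distrib)
    then show ?thesis using s(2) by (simp add: max_mult_distrib_left)
  qed
  also have "\<dots> = robustness n \<rho> - 1"
    unfolding \<rho> A.robustness_ghz_diag d by simp
  finally have R: "s * (robustness 1 \<rho>' - 1) = robustness n \<rho> - 1" .
  have oct: "\<rho>' \<notin> octahedron \<longleftrightarrow> \<bar>2 * c / s\<bar> + \<bar>(p0 - pn) / s\<bar> > 1"
    using mem_octahedron_iff[of p0 pn c] s(2) \<rho>' unfolding s_def by auto
  have gt: "\<bar>2 * c / s\<bar> + \<bar>(p0 - pn) / s\<bar> > 1 \<longleftrightarrow> c > min p0 pn"
    by (rule abs_bloch_gt_iff[OF s(2) c0 s_def])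
  have stab: "\<rho> \<notin> stab_polytope n \<longleftrightarrow> c > min p0 pn"
    unfolding \<rho> A.mem_stab_polytope_iff d by auto
  have prob: "postsel_prob n \<rho> = complex_of_real s"
    unfolding \<rho> postsel_prob_ghz_diag[OF n] d s_def ..
  have bloch: "bloch_x \<rho>' = 2 * c / s" "bloch_y \<rho>' = 0" "bloch_z \<rho>' = (p0 - pn) / s"
    unfolding \<rho>' s_def by (rule bloch_normalized)+
  show ?thesis
    unfolding s_def[symmetric]
    by (intro conjI prob s(1) \<rho>' bloch R oct gt) (simp only: stab oct gt)
qed

end
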